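(* Let $X=(X^+,X^-)$ be a piecewise analytic vector field with switching curve $\Sigma=f^{-1}(0)$. If $X$ has a $\Sigma$-monodromic singular point $p_0$ and satisfies Hypothesis H (the property defined in the context), then there is a choice of coordinates in $\Sigma$ such that in these coordinates the displacement function $\Psi=\Pi^+-(\Pi^-)^{-1}$ is analytic.
   Context: Setting. $f:\mathbb R^2\to\mathbb R$ is an analytic function having $0$ as a regular value, $\Sigma=f^{-1}(0)$, $\Sigma^{\pm}=\{p\in\mathbb R^2:\pm f(p)>0\}$. A piecewise analytic vector field $X=(X^+,X^-)$ is a pair of analytic planar vector fields, with $X=X^+$ where $f\ge 0$ and $X=X^-$ where $f\le 0$. For a vector field $Y$, $Yf=\langle\nabla f,Y\rangle$. $\Sigma$-singular points. On $\Sigma$: $SW$ is where $X^+f\cdot X^-f>0$; $ES$ is where $X^+f>0$, $X^-f<0$; $SL$ is where $X^+f<0$, $X^-f>0$. On $ES\cup SL$ the Filippov vector field $F_X(p)$ is the vector tangent to $\Sigma$ in the cone spanned by $X^+(p)$ and $X^-(p)$ (their convex combination tangent to $\Sigma$). A point $p\in\Sigma$ is $\Sigma$-regular if $p\in SW$, or if $p\in SL\cup ES$ and $F_X(p)\neq 0$; otherwise it is $\Sigma$-singular. $\Sigma$-monodromy. An isolated $\Sigma$-singular point $p$ has a $\Sigma$-characteristic orbit if one of the following holds: (1) there is a regular trajectory $\gamma$ of $X^+$ (resp. $X^-$) with $p=\gamma(t_0)$ for some $t_0$ and $p\in\overline{\gamma\cap\Sigma^+}$ (resp. $p\in\overline{\gamma\cap\Sigma^-}$);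 (2) there is a regular trajectory $\gamma$ of $X^+$ (resp. $X^-$) tending to $p$ as $t\to\infty$ or $t\to-\infty$ and a neighborhood $V$ of $p$ with $\gamma\cap V\subset V\cap\Sigma^+$ (resp. $\gamma\cap V\subset V\cap\Sigma^-$); (3) for every neighborhood $V$ of $p$ there is $q\in V\cap\Sigma$ with $X^+f(q)\cdot X^-f(q)<0$. An isolated $\Sigma$-singular point without $\Sigma$-characteristic orbits is a $\Sigma$-monodromic singular point. Hypothesis H. $X$ has an isolated $\Sigma$-monodromic singular point $p_0\in\Sigma$; without loss of generality $p_0$ is the origin and the orbits of $X$ turn around it counterclockwise. $X$ satisfies Hypothesis H if: (i) there is a continuous change of coordinates such that in the new coordinates $\Sigma$ is $\{y=0\}$; and (ii) there are positive integers $p,q,r,s$ such that in the weighted polar coordinates $(x,y)=(\rho^p\cos\theta,\rho^r\sin\theta)$ in $\Sigma\cup\Sigma^+$ and $(x,y)=(\rho^q\cos\theta,\rho^s\sin\theta)$ in $\Sigma\cup\Sigma^-$ the systems associated with $X^+$ and $X^-$ are equivalent to the differential equations $\dfrac{d\rho}{d\theta}=\dfrac{F^{\pm}(\theta,\rho)}{G^{\pm}(\theta,\rho)}$ respectively, where $F^\pm,G^\pm$ are analytic functions with $F^\pm(\theta,0)=0$ for all $\theta\in\mathbb R$, $G^+(\theta,0)\ne0$ for all $\theta\in[0,\pi]$ and $G^-(\theta,0)\neq0$ for all $\theta\in[-\pi,0]$. Return maps and displacement function. Let $\varphi^\pm(t,q)$ be the flow of $X^\pm$. The half-Poincaré return map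 $\Pi^+$ sends a point $q^+\in\Sigma$ near $p_0$ on one branch of $\Sigma\setminus\{p_0\}$ to $\varphi^+(\tau^+,q^+)\in\Sigma$ on the other branch, where $\tau^+$ is the time with $\varphi^+(t,q^+)\in\Sigma^+$ for $t$ strictly between $0$ and $\tau^+$. The half-Poincaré return map $\Pi^-$ is defined in the same way from the second branch back to the first, with $X^-$ and $\Sigma^-$; $(\Pi^-)^{-1}$ is the half-return map of $-X^-$. The displacement function is $\Psi=\Pi^+-(\Pi^-)^{-1}$, where points of $\Sigma=\{y=0\}$ are identified with their $x$-coordinate. A coordinate on $\Sigma$ here means a parameter $w\ge 0$ on the half-branch of $\Sigma$ from $p_0$ on which $\Psi$ is defined, with $w=0$ at $p_0$ (related to the $x$-coordinate by a homeomorphism, not necessarily a diffeomorphism); analytic means that $w\mapsto\Psi$ is given by a convergent power series in $w$ near $w=0$. *)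

theory Defs
  imports "HOL-Analysis.Analysis"
begin

type_synonym plane = "real \<times> real"

section \<open>Analytic functions and vector fields on the plane\<close>

text \<open>As for the library's \<^const>\<open>analytic_on\<close>, the set \<open>S\<close> need not be open: each of its points
  has a neighbourhood on which \<open>g\<close> is the sum of its (absolutely convergent) double power series.\<close>

definition real_analytic_on :: "(plane \<Rightarrow> real) \<Rightarrow> plane set \<Rightarrow> bool" where
  "real_analytic_on g S \<longleftrightarrow>
     (\<forall>(a, b) \<in> S. \<exists>r > 0. \<exists>c :: nat \<Rightarrow> nat \<Rightarrow> real. \<forall>x y. \<bar>x - a\<bar> < r \<longrightarrow> \<bar>y - b\<bar> < r \<longrightarrow>
        ((\<lambda>(m, n). c m n * (x - a) ^ m * (y - b) ^ n) has_sum g (x, y)) UNIV)"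

definition analytic_vector_field :: "(plane \<Rightarrow> plane) \<Rightarrow> bool" where
  "analytic_vector_field Y \<longleftrightarrow>
     real_analytic_on (\<lambda>p. fst (Y p)) UNIV \<and> real_analytic_on (\<lambda>p. snd (Y p)) UNIV"

definition gradient :: "(plane \<Rightarrow> real) \<Rightarrow> plane \<Rightarrow> plane" where
  "gradient f p = (THE D. GDERIV f p :> D)"

definition lie_derivative :: "(plane \<Rightarrow> plane) \<Rightarrow> (plane \<Rightarrow> real) \<Rightarrow> plane \<Rightarrow> real" where
  "lie_derivative Y f p = gradient f p \<bullet> Y p"

definition zero_regular_value :: "(plane \<Rightarrow> real) \<Rightarrow> bool" where
  "zero_regular_value f \<longleftrightarrow> (\<forall>p. f p = 0 \<longrightarrow> gradient f p \<noteq> 0)"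

text \<open>Used only for intervals \<open>I\<close>; derivatives at end points contained in \<open>I\<close> are one-sided.
  Solutions are not required to be maximal.\<close>

definition solution :: "(plane \<Rightarrow> plane) \<Rightarrow> (real \<Rightarrow> plane) \<Rightarrow> real set \<Rightarrow> bool" where
  "solution Y \<gamma> I \<longleftrightarrow> (\<forall>t\<in>I. (\<gamma> has_vector_derivative Y (\<gamma> t)) (at t within I))"

definition regular_trajectory :: "(plane \<Rightarrow> plane) \<Rightarrow> (real \<Rightarrow> plane) \<Rightarrow> real set \<Rightarrow> bool" where
  "regular_trajectory Y \<gamma> I \<longleftrightarrow>
     open I \<and> is_interval I \<and> I \<noteq> {} \<and> solution Y \<gamma> I \<and> (\<forall>t\<in>I. Y (\<gamma> t) \<noteq> 0)"

section \<open>Singular points on the switching curve\<close>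

text \<open>A piecewise vector field is given by its two components, \<open>Xp\<close> on \<open>f \<ge> 0\<close> and \<open>Xm\<close> on
  \<open>f \<le> 0\<close>.\<close>

definition Sw :: "(plane \<Rightarrow> real) \<Rightarrow> plane set" where "Sw f = {p. f p = 0}"
definition Sw_pos :: "(plane \<Rightarrow> real) \<Rightarrow> plane set" where "Sw_pos f = {p. f p > 0}"
definition Sw_neg :: "(plane \<Rightarrow> real) \<Rightarrow> plane set" where "Sw_neg f = {p. f p < 0}"

definition sewing :: "(plane \<Rightarrow> real) \<Rightarrow> (plane \<Rightarrow> plane) \<Rightarrow> (plane \<Rightarrow> plane) \<Rightarrow> plane set" where
  "sewing f Xp Xm = {p \<in> Sw f. lie_derivative Xp f p * lie_derivative Xm f p > 0}"

definition escaping :: "(plane \<Rightarrow> real) \<Rightarrow> (plane \<Rightarrow> plane) \<Rightarrow> (plane \<Rightarrow> plane) \<Rightarrow> plane set" where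
  "escaping f Xp Xm = {p \<in> Sw f. lie_derivative Xp f p > 0 \<and> lie_derivative Xm f p < 0}"

definition sliding :: "(plane \<Rightarrow> real) \<Rightarrow> (plane \<Rightarrow> plane) \<Rightarrow> (plane \<Rightarrow> plane) \<Rightarrow> plane set" where
  "sliding f Xp Xm = {p \<in> Sw f. lie_derivative Xp f p < 0 \<and> lie_derivative Xm f p > 0}"

definition filippov ::
  "(plane \<Rightarrow> real) \<Rightarrow> (plane \<Rightarrow> plane) \<Rightarrow> (plane \<Rightarrow> plane) \<Rightarrow> plane \<Rightarrow> plane" where
  "filippov f Xp Xm p = (THE v. v \<in> closed_segment (Xp p) (Xm p) \<and> gradient f p \<bullet> v = 0)"

definition Sw_regular ::
  "(plane \<Rightarrow> real) \<Rightarrow> (plane \<Rightarrow> plane) \<Rightarrow> (plane \<Rightarrow> plane) \<Rightarrow> plane \<Rightarrow> bool" where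
  "Sw_regular f Xp Xm p \<longleftrightarrow>
     p \<in> sewing f Xp Xm \<or> (p \<in> sliding f Xp Xm \<union> escaping f Xp Xm \<and> filippov f Xp Xm p \<noteq> 0)"

definition Sw_singular ::
  "(plane \<Rightarrow> real) \<Rightarrow> (plane \<Rightarrow> plane) \<Rightarrow> (plane \<Rightarrow> plane) \<Rightarrow> plane \<Rightarrow> bool" where
  "Sw_singular f Xp Xm p \<longleftrightarrow> p \<in> Sw f \<and> \<not> Sw_regular f Xp Xm p"

definition isolated_Sw_singular ::
  "(plane \<Rightarrow> real) \<Rightarrow> (plane \<Rightarrow> plane) \<Rightarrow> (plane \<Rightarrow> plane) \<Rightarrow> plane \<Rightarrow> bool" where
  "isolated_Sw_singular f Xp Xm p \<longleftrightarrow> Sw_singular f Xp Xm p \<and>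
     (\<exists>N. open N \<and> p \<in> N \<and> (\<forall>q\<in>N. Sw_singular f Xp Xm q \<longrightarrow> q = p))"

section \<open>Monodromy\<close>

definition orbit_through :: "(plane \<Rightarrow> plane) \<Rightarrow> plane set \<Rightarrow> plane \<Rightarrow> bool" where
  "orbit_through Y S p \<longleftrightarrow>
     (\<exists>\<gamma> I t0. regular_trajectory Y \<gamma> I \<and> t0 \<in> I \<and> \<gamma> t0 = p \<and> p \<in> closure (\<gamma> ` I \<inter> S))"

definition orbit_tending_to :: "(plane \<Rightarrow> plane) \<Rightarrow> plane set \<Rightarrow> plane \<Rightarrow> bool" where
  "orbit_tending_to Y S p \<longleftrightarrow>
     (\<exists>\<gamma> I a. regular_trajectory Y \<gamma> I \<and>
        (I = {a<..} \<and> (\<gamma> \<longlongrightarrow> p) at_top \<or> I = {..<a} \<and> (\<gamma> \<longlongrightarrow> p) at_bot) \<and>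
        (\<exists>N. open N \<and> p \<in> N \<and> \<gamma> ` I \<inter> N \<subseteq> N \<inter> S))"

definition has_characteristic_orbit ::
  "(plane \<Rightarrow> real) \<Rightarrow> (plane \<Rightarrow> plane) \<Rightarrow> (plane \<Rightarrow> plane) \<Rightarrow> plane \<Rightarrow> bool" where
  "has_characteristic_orbit f Xp Xm p \<longleftrightarrow>
     orbit_through Xp (Sw_pos f) p \<or> orbit_through Xm (Sw_neg f) p \<or>
     orbit_tending_to Xp (Sw_pos f) p \<or> orbit_tending_to Xm (Sw_neg f) p \<or>
     (\<forall>N. open N \<and> p \<in> N \<longrightarrow>
        (\<exists>q \<in> N \<inter> Sw f. lie_derivative Xp f q * lie_derivative Xm f q < 0))"

definition monodromic ::
  "(plane \<Rightarrow> real) \<Rightarrow> (plane \<Rightarrow> plane) \<Rightarrow> (plane \<Rightarrow> plane) \<Rightarrow> plane \<Rightarrow> bool" where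
  "monodromic f Xp Xm p \<longleftrightarrow> isolated_Sw_singular f Xp Xm p \<and> \<not> has_characteristic_orbit f Xp Xm p"

section \<open>Straightening coordinates and weighted polar coordinates\<close>

text \<open>A continuous change of coordinates \<open>\<phi>\<close> near \<open>p0\<close>, with inverse \<open>\<psi>\<close>, taking the switching
  curve to \<open>y = 0\<close>.  The sides \<open>f > 0\<close> and \<open>f < 0\<close> go to \<open>y > 0\<close> and \<open>y < 0\<close>, as is implicit in
  using angles in \<open>[0, \<pi>]\<close> for the former and in \<open>[-\<pi>, 0]\<close> for the latter.\<close>

definition straightening ::
  "(plane \<Rightarrow> real) \<Rightarrow> plane \<Rightarrow> plane set \<Rightarrow> plane set \<Rightarrow> (plane \<Rightarrow> plane) \<Rightarrow> (plane \<Rightarrow> plane) \<Rightarrow> bool"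
where
  "straightening f p0 U V \<phi> \<psi> \<longleftrightarrow>
     open U \<and> open V \<and> p0 \<in> U \<and> homeomorphism U V \<phi> \<psi> \<and> \<phi> p0 = (0, 0) \<and>
     \<phi> ` (U \<inter> Sw f) = V \<inter> {z. snd z = 0} \<and>
     \<phi> ` (U \<inter> Sw_pos f) = V \<inter> {z. snd z > 0} \<and>
     \<phi> ` (U \<inter> Sw_neg f) = V \<inter> {z. snd z < 0}"

definition weighted_polar :: "nat \<Rightarrow> nat \<Rightarrow> real \<Rightarrow> real \<Rightarrow> plane" where
  "weighted_polar a b \<theta> \<rho> = (\<rho> ^ a * cos \<theta>, \<rho> ^ b * sin \<theta>)"

text \<open>The curve \<open>c\<close> on \<open>[a, b]\<close> is an arc of an orbit of \<open>Y\<close>, up to a change of the time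
  \<open>s\<close>: continuous and injective, hence strictly monotone, but possibly reversing the orientation.\<close>

definition orbit_arc :: "(plane \<Rightarrow> plane) \<Rightarrow> (real \<Rightarrow> plane) \<Rightarrow> real \<Rightarrow> real \<Rightarrow> bool" where
  "orbit_arc Y c a b \<longleftrightarrow>
     (\<exists>s \<gamma>. continuous_on {a..b} s \<and> inj_on s {a..b} \<and> solution Y \<gamma> (s ` {a..b}) \<and>
        (\<forall>\<theta>\<in>{a..b}. c \<theta> = \<gamma> (s \<theta>)))"

text \<open>Since \<open>\<psi>\<close> is only continuous, \<open>Y\<close> cannot be transformed as a vector field.  Its equivalence
  with \<open>d\<rho>/d\<theta> = F/G\<close> in weighted polar coordinates, on the sector \<open>\<alpha> \<le> \<theta> \<le> \<beta>\<close> near \<open>\<rho> = 0\<close>,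
  means that the graphs of the solutions of this equation correspond to the orbits of \<open>Y\<close>.\<close>

definition polar_equivalent ::
  "(plane \<Rightarrow> plane) \<Rightarrow> plane set \<Rightarrow> (plane \<Rightarrow> plane) \<Rightarrow> nat \<Rightarrow> nat \<Rightarrow> real \<Rightarrow> real \<Rightarrow>
   (plane \<Rightarrow> real) \<Rightarrow> (plane \<Rightarrow> real) \<Rightarrow> bool" where
  "polar_equivalent Y V \<psi> m n \<alpha> \<beta> F G \<longleftrightarrow>
     (\<exists>\<delta> > 0.
        (\<forall>\<theta>\<in>{\<alpha>..\<beta>}. \<forall>\<rho>\<in>{0<..<\<delta>}. weighted_polar m n \<theta> \<rho> \<in> V) \<and>
        (\<forall>a b \<rho>. \<alpha> \<le> a \<longrightarrow> a < b \<longrightarrow> b \<le> \<beta> \<longrightarrow> continuous_on {a..b} \<rho> \<longrightarrow>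
           \<rho> ` {a..b} \<subseteq> {0<..<\<delta>} \<longrightarrow>
           ((\<forall>\<theta>\<in>{a..b}. (\<rho> has_real_derivative F (\<theta>, \<rho> \<theta>) / G (\<theta>, \<rho> \<theta>)) (at \<theta> within {a..b}))
            \<longleftrightarrow> orbit_arc Y (\<lambda>\<theta>. \<psi> (weighted_polar m n \<theta> (\<rho> \<theta>))) a b)))"

definition hypothesis_H ::
  "(plane \<Rightarrow> real) \<Rightarrow> (plane \<Rightarrow> plane) \<Rightarrow> (plane \<Rightarrow> plane) \<Rightarrow> plane \<Rightarrow>
   plane set \<Rightarrow> plane set \<Rightarrow> (plane \<Rightarrow> plane) \<Rightarrow> (plane \<Rightarrow> plane) \<Rightarrow> bool" where
  "hypothesis_H f Xp Xm p0 U V \<phi> \<psi> \<longleftrightarrow>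
     straightening f p0 U V \<phi> \<psi> \<and>
     (\<exists>p > 0. \<exists>q > 0. \<exists>r > 0. \<exists>s > 0. \<exists>Fp Gp Fm Gm.
        real_analytic_on Fp (UNIV \<times> {0}) \<and> real_analytic_on Gp (UNIV \<times> {0}) \<and>
        real_analytic_on Fm (UNIV \<times> {0}) \<and> real_analytic_on Gm (UNIV \<times> {0}) \<and>
        (\<forall>\<theta>. Fp (\<theta>, 0) = 0) \<and> (\<forall>\<theta>. Fm (\<theta>, 0) = 0) \<and>
        (\<forall>\<theta>\<in>{0..pi}. Gp (\<theta>, 0) \<noteq> 0) \<and> (\<forall>\<theta>\<in>{-pi..0}. Gm (\<theta>, 0) \<noteq> 0) \<and>
        polar_equivalent Xp V \<psi> p r 0 pi Fp Gp \<and>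
        polar_equivalent Xm V \<psi> q s (-pi) 0 Fm Gm)"

section \<open>Half-return maps and displacement function\<close>

text \<open>Points of the switching curve near \<open>p0\<close> are identified with their coordinate \<open>x\<close>, that is,
  \<open>x\<close> stands for \<open>\<psi> (x, 0)\<close>; the two branches are \<open>x > 0\<close> and \<open>x < 0\<close>, and \<open>p0\<close> is \<open>x = 0\<close>.\<close>

definition half_returns ::
  "(plane \<Rightarrow> plane) \<Rightarrow> plane set \<Rightarrow> plane set \<Rightarrow> (plane \<Rightarrow> plane) \<Rightarrow> real \<Rightarrow> real \<Rightarrow> bool" where
  "half_returns Y S V \<psi> x x' \<longleftrightarrow>
     (x, 0) \<in> V \<and> (x', 0) \<in> V \<and> x * x' < 0 \<and>
     (\<exists>\<tau> > 0. \<exists>\<gamma>. solution Y \<gamma> {0..\<tau>} \<and> \<gamma> 0 = \<psi> (x, 0) \<and> \<gamma> \<tau> = \<psi> (x', 0) \<and>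
        (\<forall>t\<in>{0<..<\<tau>}. \<gamma> t \<in> S))"

definition half_return ::
  "(plane \<Rightarrow> plane) \<Rightarrow> plane set \<Rightarrow> plane set \<Rightarrow> (plane \<Rightarrow> plane) \<Rightarrow> real \<Rightarrow> real" where
  "half_return Y S V \<psi> x = (if x = 0 then 0 else (THE x'. half_returns Y S V \<psi> x x'))"

text \<open>The inverse of the half-return map of \<open>Xm\<close> is the half-return map of \<open>-Xm\<close>.\<close>

definition displacement ::
  "(plane \<Rightarrow> real) \<Rightarrow> (plane \<Rightarrow> plane) \<Rightarrow> (plane \<Rightarrow> plane) \<Rightarrow> plane set \<Rightarrow> (plane \<Rightarrow> plane) \<Rightarrow>
   real \<Rightarrow> real" where
  "displacement f Xp Xm V \<psi> x =
     half_return Xp (Sw_pos f) V \<psi> x - half_return (\<lambda>p. - Xm p) (Sw_neg f) V \<psi> x"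

definition displacement_defined ::
  "(plane \<Rightarrow> real) \<Rightarrow> (plane \<Rightarrow> plane) \<Rightarrow> (plane \<Rightarrow> plane) \<Rightarrow> plane set \<Rightarrow> (plane \<Rightarrow> plane) \<Rightarrow>
   real \<Rightarrow> bool" where
  "displacement_defined f Xp Xm V \<psi> x \<longleftrightarrow>
     (\<exists>!x'. half_returns Xp (Sw_pos f) V \<psi> x x') \<and>
     (\<exists>!x'. half_returns (\<lambda>p. - Xm p) (Sw_neg f) V \<psi> x x')"

text \<open>The point with parameter \<open>w \<in> [0, \<epsilon>)\<close> is \<open>x = h w\<close>, on the branch of sign \<open>\<sigma>\<close>.\<close>

definition branch_coordinate :: "real \<Rightarrow> real \<Rightarrow> (real \<Rightarrow> real) \<Rightarrow> bool" where
  "branch_coordinate \<sigma> \<epsilon> h \<longleftrightarrow> h 0 = 0 \<and>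
     (\<exists>\<kappa> > 0. \<exists>k. homeomorphism {0..<\<epsilon>} ((\<lambda>u. \<sigma> * u) ` {0..<\<kappa>}) h k)"

end

theory Submission
  imports Defs "HOL-Complex_Analysis.Complex_Analysis"
begin

text \<open>In weighted polar coordinates the half-return maps are the flow maps over an angle \<open>\<pi>\<close> of
  \<open>d\<rho>/d\<theta> = F/G\<close>.  The right-hand side extends to complex \<open>\<rho>\<close> near \<open>0\<close> and vanishes at \<open>\<rho> = 0\<close>, so
  on short intervals of \<open>\<theta>\<close> the Picard iterates are holomorphic in the initial value and converge
  uniformly; composing finitely many short flows gives maps \<open>P\<close> and \<open>Q\<close> that are analytic at \<open>0\<close>.
  On the switching curve \<open>\<bar>x\<bar>\<close> is \<open>\<rho>\<^sup>p\<close> for the upper and \<open>\<rho>\<^sup>q\<close> for the lower coordinates, so with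
  \<open>x = \<sigma> w\<^sup>p\<^sup>q\<close> the initial values are \<open>w\<^sup>q\<close> and \<open>w\<^sup>p\<close>, and \<open>\<Psi> = \<sigma> (Q (w\<^sup>p)\<^sup>q - P (w\<^sup>q)\<^sup>p)\<close>.
  Monodromy enters only through the orientation: all points of the curve near \<open>p0\<close> other than \<open>p0\<close>
  are sewing, which makes both half-returns leave from the same branch, of sign \<open>\<sigma>\<close>.\<close>

section \<open>Double power series\<close>

text \<open>Complex initial values are used because a locally uniform limit of holomorphic functions
  is holomorphic, while a uniform limit of real analytic functions need not be analytic. The angle
  stays real, and the flow estimates use joint continuity in it. F and G are controlled only near
  \<rho> = 0, and the polar equivalence speaks only of solutions with 0 < \<rho> < \<delta>.
  Solutions must therefore stay small and positive; since F vanishes at \<rho> = 0, a short flow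
  moves z by at most |z| / 2, which gives both. As \<psi> is merely continuous, the polar equation
  cannot tell in which direction an orbit runs along an arc. The direction is read off from the sign
  of a Lie derivative at an end point. Half-returns are definite descriptions over all solutions of
  the original field, so uniqueness is proved in the plane, from a Lipschitz estimate. The exponent
  pq makes both radial variables, the p-th and the q-th root of the absolute value of x, powers of
  w.\<close>

definition biseries :: "(nat \<Rightarrow> nat \<Rightarrow> 'a) \<Rightarrow> 'a \<Rightarrow> 'a \<Rightarrow> 'a::{real_normed_field, banach}" where
  "biseries c x y = (\<Sum>\<^sub>\<infinity>(m, n). c m n * x ^ m * y ^ n)"

text \<open>Absolute convergence on all closed bidiscs of radius below r. Only norms of coefficients
  enter, so the condition passes unchanged from a real series to its complexification.\<close>

definition biseries_conv :: "(nat \<Rightarrow> nat \<Rightarrow> 'a::{real_normed_field, banach}) \<Rightarrow> real \<Rightarrow> bool" where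
  "biseries_conv c r \<longleftrightarrow>
     (\<forall>s. 0 \<le> s \<longrightarrow> s < r \<longrightarrow> (\<lambda>(m, n). norm (c m n) * s ^ m * s ^ n) summable_on UNIV)"

text \<open>Coefficients of the formal partial derivative in the first variable; the second variable
  is reached by transposing the coefficients.\<close>

definition biseries_diff :: "(nat \<Rightarrow> nat \<Rightarrow> 'a::{real_normed_field, banach}) \<Rightarrow> nat \<Rightarrow> nat \<Rightarrow> 'a" where
  "biseries_diff c m n = of_nat (Suc m) * c (Suc m) n"

lemma biseries_abs_summable:
  assumes "biseries_conv c r" "norm x < r" "norm y < r"
  shows "(\<lambda>(m, n). norm (c m n * x ^ m * y ^ n)) summable_on UNIV"
proof -
  define s where "s = max (norm x) (norm y)"
  have s: "0 \<le> s" "s < r" "norm x \<le> s" "norm y \<le> s"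
    using assms by (auto simp: s_def le_max_iff_disj)
  have "(\<lambda>p. norm ((\<lambda>(m, n). c m n * x ^ m * y ^ n) p)) summable_on UNIV"
  proof (rule Infinite_Sum.abs_summable_on_comparison_test')
    show "(\<lambda>(m, n). norm (c m n) * s ^ m * s ^ n) summable_on UNIV"
      using assms(1) s by (auto simp: biseries_conv_def)
    show "norm ((\<lambda>(m, n). c m n * x ^ m * y ^ n) p) \<le> (\<lambda>(m, n). norm (c m n) * s ^ m * s ^ n) p" for p
      using s by (auto simp: norm_mult norm_power split_beta intro!: mult_mono power_mono)
  qed
  then show ?thesis by (simp add: case_prod_unfold)
qed

lemma biseries_has_sum:
  assumes "biseries_conv c r" "norm x < r" "norm y < r"
  shows "((\<lambda>(m, n). c m n * x ^ m * y ^ n) has_sum biseries c x y) UNIV"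
  unfolding biseries_def
  by (rule has_sum_infsum, rule abs_summable_summable)
     (use biseries_abs_summable[OF assms] in \<open>simp add: case_prod_unfold\<close>)

text \<open>The Weierstrass M-test with the majorant at radius s gives continuity on each closed
  bidisc with s < r, and every point of the open bidisc is interior to one of these.\<close>

lemma biseries_continuous_on:
  assumes "biseries_conv c r"
  shows "continuous_on (ball 0 r \<times> ball 0 r) (\<lambda>(x, y). biseries c x y)"
proof -
  have *: "continuous_on (cball 0 s \<times> cball 0 s) (\<lambda>(x, y). biseries c x y)"
    if s: "0 \<le> s" "s < r" for s
  proof -
    have "uniform_limit (cball 0 s \<times> cball 0 s)
        (\<lambda>X z. \<Sum>p\<in>X. (\<lambda>(m, n). c m n * fst z ^ m * snd z ^ n) p)
        (\<lambda>z. biseries c (fst z) (snd z)) (finite_subsets_at_top UNIV)"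
    proof (rule Weierstrass_m_test_general')
      show "(\<lambda>(m, n). norm (c m n) * s ^ m * s ^ n) summable_on UNIV"
        using assms s by (auto simp: biseries_conv_def)
      show "norm ((\<lambda>(m, n). c m n * fst z ^ m * snd z ^ n) p) \<le>
          (\<lambda>(m, n). norm (c m n) * s ^ m * s ^ n) p"
        if "z \<in> cball 0 s \<times> cball 0 s" for p z
        using that s by (auto simp: norm_mult norm_power split_beta intro!: mult_mono power_mono)
      show "((\<lambda>p. case p of (m, n) \<Rightarrow> c m n * fst z ^ m * snd z ^ n) has_sum
          biseries c (fst z) (snd z)) UNIV"
        if "z \<in> cball 0 s \<times> cball 0 s" for z
        using that s by (intro biseries_has_sum[OF assms]) auto
    qed
    then show ?thesis
      unfolding split_beta
      by (rule uniform_limit_theorem[rotated])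
         (auto intro!: always_eventually continuous_intros)
  qed
  show ?thesis
  proof (rule continuous_at_imp_continuous_on, clarify)
    fix x y :: 'a assume xy: "x \<in> ball 0 r" "y \<in> ball 0 r"
    define s where "s = (max (norm x) (norm y) + r) / 2"
    have s: "0 \<le> s" "s < r" "norm x < s" "norm y < s"
      using xy norm_ge_zero[of x] norm_ge_zero[of y] unfolding s_def max_def mem_ball dist_0_norm
      by (auto simp: field_simps simp del: norm_ge_zero)
    have "continuous_on (ball 0 s \<times> ball 0 s) (\<lambda>(x, y). biseries c x y)"
      by (rule continuous_on_subset[OF *[OF s(1,2)]]) auto
    then show "isCont (\<lambda>(x, y). biseries c x y) (x, y)"
      by (subst (asm) continuous_on_eq_continuous_at) (use s in \<open>auto intro!: open_Times\<close>)
  qed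
qed

text \<open>The factor m + 1 costs an arbitrarily small part of the radius: for s < t < r the
  numbers (m + 1) * (s / t)^m are bounded, so the differentiated series at radius s is dominated by
  a multiple of the original one at radius t.\<close>

lemma biseries_conv_diff:
  assumes "biseries_conv c r"
  shows "biseries_conv (biseries_diff c) r"
  unfolding biseries_conv_def
proof (intro allI impI)
  fix s :: real assume s: "0 \<le> s" "s < r"
  define t where "t = (s + r) / 2"
  have t: "0 < t" "s < t" "t < r" using s by (auto simp: t_def)
  \<comment> \<open>These are the terms of the termwise derivative of the geometric series at s / t
    < 1, hence a null sequence.\<close>
  have "(\<lambda>m. of_nat (Suc m) * (s / t) ^ m) \<longlonglongrightarrow> 0"
  proof (rule summable_LIMSEQ_zero)
    have "summable (\<lambda>m. diffs (\<lambda>_. 1) m * (s / t) ^ m)"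
      by (rule termdiff_converges[where K = 1]) (use s t in \<open>auto intro!: summable_geometric\<close>)
    then show "summable (\<lambda>m. of_nat (Suc m) * (s / t) ^ m)" by (simp add: diffs_def)
  qed
  then have "Bseq (\<lambda>m. of_nat (Suc m) * (s / t) ^ m)"
    by (intro convergent_imp_Bseq) (auto simp: convergent_def)
  then obtain K where K: "\<And>m. norm (of_nat (Suc m) * (s / t) ^ m) \<le> K"
    unfolding Bseq_def by blast
  \<comment> \<open>\<open>K / t * t ^ Suc m\<close> is K * t^m written with the exponent of the
    shifted term, so that the majorant is the original series along the injection (m, n) to (m + 1,
    n).\<close>
  have K': "of_nat (Suc m) * s ^ m \<le> K / t * t ^ Suc m" for m
    using K[of m] s t by (simp add: field_simps)
  have inj: "inj_on (\<lambda>(m, n). (Suc m, n)) UNIV" by (auto simp: inj_on_def)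
  have sm: "(\<lambda>(m, n). norm (c m n) * t ^ m * t ^ n) summable_on UNIV"
    using assms t by (auto simp: biseries_conv_def)
  have "(\<lambda>(m, n). norm (c m n) * t ^ m * t ^ n) summable_on ((\<lambda>(m, n). (Suc m, n)) ` UNIV)"
    by (rule summable_on_subset_banach[OF sm]) auto
  then have "((\<lambda>(m, n). norm (c m n) * t ^ m * t ^ n) \<circ> (\<lambda>(m, n). (Suc m, n))) summable_on UNIV"
    by (subst summable_on_reindex[OF inj, symmetric])
  then have *: "(\<lambda>p. K / t * ((\<lambda>(m, n). norm (c m n) * t ^ m * t ^ n) \<circ> (\<lambda>(m, n). (Suc m, n))) p)
      summable_on UNIV"
    by (rule summable_on_cmult_right)
  have "(\<lambda>p. norm ((\<lambda>(m, n). norm (biseries_diff c m n) * s ^ m * s ^ n) p)) summable_on UNIV"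
  proof (rule Infinite_Sum.abs_summable_on_comparison_test'[OF *])
    fix p :: "nat \<times> nat"
    obtain m n where p: "p = (m, n)" by force
    have "norm (c (Suc m) n) * (of_nat (Suc m) * s ^ m) * s ^ n \<le>
        norm (c (Suc m) n) * (K / t * t ^ Suc m) * t ^ n"
      using s t K[of 0] by (intro mult_mono K' power_mono) (auto intro!: mult_nonneg_nonneg)
    then show "norm ((\<lambda>(m, n). norm (biseries_diff c m n) * s ^ m * s ^ n) p) \<le>
      K / t * ((\<lambda>(m, n). norm (c m n) * t ^ m * t ^ n) \<circ> (\<lambda>(m, n). (Suc m, n))) p"
      using s t by (simp add: p biseries_diff_def norm_mult abs_mult norm_power mult_ac del: of_nat_Suc)
  qed
  then show "(\<lambda>(m, n). norm (biseries_diff c m n) * s ^ m * s ^ n) summable_on UNIV"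
    by (rule abs_summable_summable)
qed

text \<open>Summing over n first produces a power series in x, to which termwise differentiation in
  one variable applies. The inner sums come from the rows by dividing by x^m, so x = 0 is separate:
  there only the row m = 0 survives.\<close>

lemma biseries_sums:
  assumes "biseries_conv c r" "norm x < r" "norm y < r"
  shows "(\<lambda>m. (\<Sum>\<^sub>\<infinity>n. c m n * y ^ n) * x ^ m) sums biseries c x y"
proof (cases "x = 0")
  case True
  have "biseries c x y = (\<Sum>\<^sub>\<infinity>p\<in>range (Pair 0). (\<lambda>(m, n). c m n * x ^ m * y ^ n) p)"
    unfolding biseries_def by (rule infsum_cong_neutral) (use True in auto)
  also have "\<dots> = (\<Sum>\<^sub>\<infinity>n. c 0 n * y ^ n)"
    by (subst infsum_reindex) (auto simp: inj_on_def o_def)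
  finally show ?thesis
    using powser_sums_zero[of "\<lambda>m. (\<Sum>\<^sub>\<infinity>n. c m n * y ^ n)"] True by simp
next
  case False
  have 0: "(\<lambda>(m, n). norm (c m n * x ^ m * y ^ n)) summable_on Sigma UNIV (\<lambda>_. UNIV)"
    using biseries_abs_summable[OF assms] by simp
  have 1: "(\<lambda>n. c m n * x ^ m * y ^ n) summable_on UNIV" for m
  proof -
    have "(\<lambda>n. norm (c m n * x ^ m * y ^ n)) summable_on UNIV"
      using summable_on_SigmaD1[OF 0, of m] by (simp add: split_beta)
    then show ?thesis by (rule abs_summable_summable)
  qed
  have 2: "((\<lambda>n. c m n * x ^ m * y ^ n) has_sum ((\<Sum>\<^sub>\<infinity>n. c m n * y ^ n) * x ^ m)) UNIV" for m
  proof -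
    have "(\<lambda>n. c m n * x ^ m * y ^ n * (1 / x ^ m)) summable_on UNIV"
      by (rule summable_on_cmult_left[OF 1])
    then have "(\<lambda>n. c m n * y ^ n) summable_on UNIV"
      using False by (simp add: field_simps)
    then have "((\<lambda>n. c m n * y ^ n * x ^ m) has_sum ((\<Sum>\<^sub>\<infinity>n. c m n * y ^ n) * x ^ m)) UNIV"
      by (intro has_sum_cmult_left has_sum_infsum)
    then show ?thesis by (simp add: mult_ac)
  qed
  have "((\<lambda>(m, n). c m n * x ^ m * y ^ n) has_sum biseries c x y) (Sigma UNIV (\<lambda>_. UNIV))"
    using biseries_has_sum[OF assms] by simp
  then have "((\<lambda>m. (\<Sum>\<^sub>\<infinity>n. c m n * y ^ n) * x ^ m) has_sum biseries c x y) UNIV"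
    by (rule has_sum_SigmaD) (use 2 in auto)
  then show ?thesis by (rule has_sum_imp_sums)
qed

lemma biseries_deriv:
  assumes c: "biseries_conv c r" and "norm x < r" "norm y < r"
  shows "((\<lambda>x. biseries c x y) has_field_derivative biseries (biseries_diff c) x y) (at x)"
proof -
  define d where "d m = (\<Sum>\<^sub>\<infinity>n. c m n * y ^ n)" for m
  have s: "(\<lambda>m. d m * x ^ m) sums biseries c x y" if "norm x < r" for x
    using biseries_sums[OF c that assms(3)] by (simp add: d_def)
  have "((\<lambda>x. \<Sum>m. d m * x ^ m) has_field_derivative (\<Sum>m. diffs d m * x ^ m)) (at x)"
    by (rule termdiffs_strong'[of r]) (use s assms in \<open>auto dest: sums_summable\<close>)
  also have "(\<Sum>m. diffs d m * x ^ m) = biseries (biseries_diff c) x y"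
  proof -
    have "diffs d m = (\<Sum>\<^sub>\<infinity>n. biseries_diff c m n * y ^ n)" for m
      unfolding diffs_def d_def biseries_diff_def mult.assoc
      by (subst infsum_cmult_right') simp
    then show ?thesis
      using biseries_sums[OF biseries_conv_diff[OF c] assms(2,3)] by (simp add: sums_iff)
  qed
  finally show ?thesis
  proof (rule has_field_derivative_transform_within_open)
    show "x \<in> ball 0 r" using assms by simp
    show "(\<Sum>m. d m * x ^ m) = biseries c x y" if "x \<in> ball 0 r" for x
      using s[of x] that by (simp add: sums_iff)
  qed auto
qed

lemma biseries_swap: "biseries (\<lambda>m n. c n m) y x = biseries c x y"
proof -
  have "biseries (\<lambda>m n. c n m) y x = (\<Sum>\<^sub>\<infinity>p\<in>prod.swap ` UNIV. (\<lambda>(m, n). c n m * y ^ m * x ^ n) p)"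
    by (simp add: biseries_def)
  also have "\<dots> = biseries c x y"
    unfolding biseries_def
    by (subst infsum_reindex) (auto intro!: infsum_cong simp: mult_ac)
  finally show ?thesis .
qed

lemma biseries_conv_swap:
  assumes "biseries_conv c r"
  shows "biseries_conv (\<lambda>m n. c n m) r"
  unfolding biseries_conv_def
proof (intro allI impI)
  fix s :: real assume s: "0 \<le> s" "s < r"
  have "(\<lambda>(m, n). norm (c m n) * s ^ m * s ^ n) summable_on prod.swap ` UNIV"
    using assms s by (simp add: biseries_conv_def)
  then show "(\<lambda>(m, n). norm (c n m) * s ^ m * s ^ n) summable_on UNIV"
    by (subst (asm) summable_on_reindex) (auto simp: o_def case_prod_unfold mult_ac)
qed

text \<open>Transpose the coefficients, differentiate in the first variable and transpose
  back.\<close>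

lemma biseries_deriv_snd:
  assumes c: "biseries_conv c r"
  obtains c' where "biseries_conv c' r"
    "\<And>x y. norm x < r \<Longrightarrow> norm y < r \<Longrightarrow>
      ((\<lambda>y. biseries c x y) has_field_derivative biseries c' x y) (at y)"
proof
  let ?s = "\<lambda>c m n. c n m"
  show "biseries_conv (?s (biseries_diff (?s c))) r"
    by (rule biseries_conv_swap[OF biseries_conv_diff[OF biseries_conv_swap[OF c]]])
  show "((\<lambda>y. biseries c x y) has_field_derivative biseries (?s (biseries_diff (?s c))) x y) (at y)"
    if "norm x < r" "norm y < r" for x y
    using biseries_deriv[OF biseries_conv_swap[OF c] that(2,1)]
    unfolding biseries_swap[of "?s (biseries_diff (?s c))" y x] biseries_swap[of c] .
qed

section \<open>Analytic functions and vector fields on the plane\<close>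

text \<open>A summable real family is absolutely summable, so convergence at the diagonal points (s,
  s) already gives \<open>biseries_conv\<close>.\<close>

lemma real_analytic_on_biseries:
  assumes "real_analytic_on g S" "(a, b) \<in> S"
  obtains r c where "r > 0" "biseries_conv c r"
    "\<And>x y. \<bar>x\<bar> < r \<Longrightarrow> \<bar>y\<bar> < r \<Longrightarrow> g (a + x, b + y) = biseries c x y"
proof -
  obtain r c where r: "r > 0" and c: "\<And>x y. \<bar>x - a\<bar> < r \<Longrightarrow> \<bar>y - b\<bar> < r \<Longrightarrow>
        ((\<lambda>(m, n). c m n * (x - a) ^ m * (y - b) ^ n) has_sum g (x, y)) UNIV"
    using assms unfolding real_analytic_on_def by force
  have c': "((\<lambda>(m, n). c m n * x ^ m * y ^ n) has_sum g (a + x, b + y)) UNIV"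
    if "\<bar>x\<bar> < r" "\<bar>y\<bar> < r" for x y
    using c[of "a + x" "b + y"] that by simp
  have "biseries_conv c r"
    unfolding biseries_conv_def
  proof (intro allI impI)
    fix s :: real assume s: "0 \<le> s" "s < r"
    have "(\<lambda>(m, n). c m n * s ^ m * s ^ n) summable_on UNIV"
      using c'[of s s] s by (auto simp: has_sum_iff)
    then have "(\<lambda>p. norm ((\<lambda>(m, n). c m n * s ^ m * s ^ n) p)) summable_on UNIV"
      by (subst (asm) summable_on_iff_abs_summable_on_real)
    then show "(\<lambda>(m, n). norm (c m n) * s ^ m * s ^ n) summable_on UNIV"
      using s by (simp add: case_prod_unfold abs_mult)
  qed
  moreover have "g (a + x, b + y) = biseries c x y" if "\<bar>x\<bar> < r" "\<bar>y\<bar> < r" for x y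
    using c'[OF that] unfolding biseries_def by (rule infsumI[symmetric])
  ultimately show thesis using r that by blast
qed

text \<open>Total differentiability follows from one partial derivative at the point and a
  continuous other one. The derivative is written as an inner product so that it identifies the
  gradient.\<close>

lemma biseries_has_derivative:
  fixes c :: "nat \<Rightarrow> nat \<Rightarrow> real"
  assumes c: "biseries_conv c r"
  obtains gx gy where "continuous_on (ball 0 r \<times> ball 0 r) gx"
    "continuous_on (ball 0 r \<times> ball 0 r) gy"
    "\<And>q. q \<in> ball 0 r \<times> ball 0 r \<Longrightarrow>
      ((\<lambda>(x, y). biseries c x y) has_derivative (\<lambda>h. h \<bullet> (gx q, gy q))) (at q)"
proof (cases "r > 0")
  case False
  then show thesis using that[of "\<lambda>_. 0" "\<lambda>_. 0"] by (simp add: not_less ball_empty)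
next
  case True
  then obtain c' where c': "biseries_conv c' r"
    and d2: "\<And>x y. norm x < r \<Longrightarrow> norm y < r \<Longrightarrow>
      ((\<lambda>y. biseries c x y) has_field_derivative biseries c' x y) (at y)"
    using biseries_deriv_snd[OF c] by blast
  let ?B = "ball 0 r :: real set"
  define gx gy where "gx = (\<lambda>(x, y). biseries (biseries_diff c) x y)"
    and "gy = (\<lambda>(x, y). biseries c' x y)"
  have gx: "continuous_on (?B \<times> ?B) gx" and gy: "continuous_on (?B \<times> ?B) gy"
      unfolding gx_def gy_def
    by (rule biseries_continuous_on[OF biseries_conv_diff[OF c]], rule biseries_continuous_on[OF c'])
  have "((\<lambda>(x, y). biseries c x y) has_derivative (\<lambda>h. h \<bullet> (gx q, gy q))) (at q)"
    if q: "q \<in> ?B \<times> ?B" for q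
  proof -
    obtain x y where xy: "q = (x, y)" by force
    have "((\<lambda>(x, y). biseries c x y) has_derivative
        (\<lambda>(tx, ty). gx (x, y) * tx + blinfun_apply (blinfun_mult_right (gy (x, y))) ty)) (at (x, y) within ?B \<times> ?B)"
    proof (rule has_derivative_partialsI)
      show "((\<lambda>x. biseries c x y) has_derivative (*) (gx (x, y))) (at x within ?B)"
        using biseries_deriv[OF c, of x y] q xy
        by (auto simp: gx_def has_field_derivative_def intro: has_derivative_at_withinI)
      show "((\<lambda>y. biseries c x y) has_derivative blinfun_apply (blinfun_mult_right (gy (x, y)))) (at y within ?B)"
        if "x \<in> ?B" "y \<in> ?B" for x y
        using d2[of x y] that
        by (auto simp: gy_def has_field_derivative_def intro: has_derivative_at_withinI)
      show "continuous (at (x, y) within ?B \<times> ?B) (\<lambda>(x, y). blinfun_mult_right (gy (x, y)))"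
        using gy q xy unfolding continuous_on_eq_continuous_within
        by (auto intro!: bounded_linear.continuous[OF bounded_linear_blinfun_mult_right] simp: case_prod_unfold)
    qed (use q xy in auto)
    moreover have "at (x, y) within ?B \<times> ?B = at (x, y)"
      by (rule at_within_open) (use q xy in \<open>auto intro: open_Times\<close>)
    ultimately show ?thesis
      by (simp add: xy case_prod_unfold inner_prod_def mult.commute)
  qed
  then show thesis using that gx gy by blast
qed

lemma real_analytic_on_C1:
  assumes "real_analytic_on g S" "p \<in> S"
  obtains r D where "r > 0" "continuous_on (ball p r) D"
    "\<And>q. q \<in> ball p r \<Longrightarrow> (g has_derivative (\<lambda>h. h \<bullet> D q)) (at q)"
proof -
  obtain a b where p: "p = (a, b)" by force
  obtain r c where r: "r > 0" "biseries_conv c r"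
    and g: "\<And>x y. \<bar>x\<bar> < r \<Longrightarrow> \<bar>y\<bar> < r \<Longrightarrow> g (a + x, b + y) = biseries c x y"
    using real_analytic_on_biseries[OF assms(1)] assms(2) p by metis
  obtain gx gy where gx: "continuous_on (ball 0 r \<times> ball 0 r) gx"
    and gy: "continuous_on (ball 0 r \<times> ball 0 r) gy"
    and d: "\<And>q. q \<in> ball 0 r \<times> ball 0 r \<Longrightarrow>
      ((\<lambda>(x, y). biseries c x y) has_derivative (\<lambda>h. h \<bullet> (gx q, gy q))) (at q)"
    using biseries_has_derivative[OF r(2)] by blast
  have sub: "q - p \<in> ball 0 r \<times> ball 0 r" if "q \<in> ball p r" for q
  proof -
    have "norm (q - p) < r" using that by (simp add: dist_norm norm_minus_commute)
    then have "norm (fst (q - p)) < r" "norm (snd (q - p)) < r"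
      using norm_fst_le[of "fst (q - p)" "snd (q - p)"] norm_snd_le[of "snd (q - p)" "fst (q - p)"]
      unfolding prod.collapse by linarith+
    then show ?thesis by (simp add: mem_Times_iff)
  qed
  show thesis
  proof
    show "r > 0" by fact
    show "continuous_on (ball p r) (\<lambda>q. (gx (q - p), gy (q - p)))"
      by (intro continuous_intros continuous_on_compose2[OF gx] continuous_on_compose2[OF gy])
         (use sub in \<open>simp_all add: image_subset_iff\<close>)
    fix q assume q: "q \<in> ball p r"
    have "((\<lambda>(x, y). biseries c x y) \<circ> (\<lambda>q. q - p) has_derivative
        (\<lambda>h. h \<bullet> (gx (q - p), gy (q - p))) \<circ> (\<lambda>h. h)) (at q)"
      by (rule diff_chain_at) (auto intro!: derivative_eq_intros d[OF sub[OF q]])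
    then have "((\<lambda>q. biseries c (fst (q - p)) (snd (q - p))) has_derivative
        (\<lambda>h. h \<bullet> (gx (q - p), gy (q - p)))) (at q)"
      by (simp add: o_def case_prod_unfold)
    then show "(g has_derivative (\<lambda>h. h \<bullet> (gx (q - p), gy (q - p)))) (at q)"
    proof (rule has_derivative_transform_within_open[OF _ open_ball q])
      fix x assume "x \<in> ball p r"
      then show "biseries c (fst (x - p)) (snd (x - p)) = g x"
        using sub[of x] g[of "fst (x - p)" "snd (x - p)"] by (cases x) (auto simp: p)
    qed
  qed
qed

lemma gradient_eqI:
  assumes "(f has_derivative (\<lambda>h. h \<bullet> D)) (at p)"
  shows "gradient f p = D"
  unfolding gradient_def gderiv_def
proof (rule the_equality, rule assms)
  fix D' assume "(f has_derivative (\<lambda>h. h \<bullet> D')) (at p)"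
  from has_derivative_unique[OF this assms]
  show "D' = D" by (metis inner_commute vector_eq_rdot)
qed

lemma real_analytic_has_derivative:
  assumes "real_analytic_on f UNIV"
  shows "(f has_derivative (\<lambda>h. h \<bullet> gradient f p)) (at p)"
  using real_analytic_on_C1[OF assms, of p] gradient_eqI[of f _ p]
  by (metis UNIV_I centre_in_ball)

lemma continuous_on_gradient:
  assumes "real_analytic_on f UNIV"
  shows "continuous_on UNIV (gradient f)"
proof (rule continuous_at_imp_continuous_on, rule ballI)
  fix p
  obtain r D where r: "r > 0" and c: "continuous_on (ball p r) D"
    and d: "\<And>q. q \<in> ball p r \<Longrightarrow> (f has_derivative (\<lambda>h. h \<bullet> D q)) (at q)"
    using real_analytic_on_C1[OF assms, of p] by auto
  have "continuous_on (ball p r) (gradient f)"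
    using c by (rule continuous_on_eq) (use gradient_eqI[OF d] in auto)
  then show "isCont (gradient f) p"
    using r by (simp add: continuous_on_eq_continuous_at)
qed

section \<open>Local Lipschitz continuity and uniqueness of solutions\<close>

definition locally_lipschitz :: "(plane \<Rightarrow> plane) \<Rightarrow> bool" where
  "locally_lipschitz Y \<longleftrightarrow>
     (\<forall>p. \<exists>e>0. \<exists>L. \<forall>q\<in>ball p e. \<forall>q'\<in>ball p e. norm (Y q - Y q') \<le> L * norm (q - q'))"

text \<open>The continuous gradient is bounded on the compact ball \<open>cball p 1\<close>, and the
  mean value inequality on the convex open ball turns this bound into a Lipschitz constant.\<close>

lemma real_analytic_locally_lipschitz:
  assumes "real_analytic_on g UNIV"
  shows "\<exists>e>0. \<exists>L. \<forall>q\<in>ball p e. \<forall>q'\<in>ball p e. \<bar>g q - g q'\<bar> \<le> L * norm (q - q')"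
proof -
  have "compact (gradient g ` cball p 1)"
    by (intro compact_continuous_image continuous_on_subset[OF continuous_on_gradient[OF assms]]) auto
  then obtain L where L: "\<And>q. q \<in> cball p 1 \<Longrightarrow> norm (gradient g q) \<le> L"
    by (meson compact_imp_bounded bounded_iff imageI)
  have "norm (g q - g q') \<le> L * norm (q - q')" if "q \<in> ball p 1" "q' \<in> ball p 1" for q q'
  proof (rule differentiable_bound[OF convex_ball[of p 1]])
    show "(g has_derivative (\<lambda>h. h \<bullet> gradient g x)) (at x within ball p 1)" for x
      by (rule has_derivative_at_withinI[OF real_analytic_has_derivative[OF assms]])
    show "onorm (\<lambda>h. h \<bullet> gradient g x) \<le> L" if "x \<in> ball p 1" for x
    proof (rule onorm_bound)
      show "0 \<le> L" by (rule order_trans[OF norm_ge_zero L[of p]]) simp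
      show "norm (h \<bullet> gradient g x) \<le> L * norm h" for h
        using Cauchy_Schwarz_ineq2[of h "gradient g x"] L[of x] that
          mult_left_mono[of "norm (gradient g x)" L "norm h"] by (auto simp: mult.commute)
    qed
  qed (use that in auto)
  then show ?thesis by (metis real_norm_def zero_less_one)
qed

lemma analytic_vector_field_locally_lipschitz:
  assumes "analytic_vector_field Y"
  shows "locally_lipschitz Y"
  unfolding locally_lipschitz_def
proof
  fix p
  obtain e1 L1 where 1: "e1 > 0" "\<forall>q\<in>ball p e1. \<forall>q'\<in>ball p e1. \<bar>fst (Y q) - fst (Y q')\<bar> \<le> L1 * norm (q - q')"
    using real_analytic_locally_lipschitz[of "\<lambda>p. fst (Y p)" p] assms by (auto simp: analytic_vector_field_def)
  obtain e2 L2 where 2: "e2 > 0" "\<forall>q\<in>ball p e2. \<forall>q'\<in>ball p e2. \<bar>snd (Y q) - snd (Y q')\<bar> \<le> L2 * norm (q - q')"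
    using real_analytic_locally_lipschitz[of "\<lambda>p. snd (Y p)" p] assms by (auto simp: analytic_vector_field_def)
  have "norm (Y q - Y q') \<le> (L1 + L2) * norm (q - q')"
    if "q \<in> ball p (min e1 e2)" "q' \<in> ball p (min e1 e2)" for q q'
  proof -
    have "norm (Y q - Y q') \<le> norm (fst (Y q - Y q')) + norm (snd (Y q - Y q'))"
      using norm_Pair_le[of "fst (Y q - Y q')" "snd (Y q - Y q')"] unfolding prod.collapse .
    also have "\<dots> \<le> L1 * norm (q - q') + L2 * norm (q - q')"
      using 1 2 that by (intro add_mono) auto
    finally show ?thesis by (simp add: algebra_simps)
  qed
  then show "\<exists>e>0. \<exists>L. \<forall>q\<in>ball p e. \<forall>q'\<in>ball p e. norm (Y q - Y q') \<le> L * norm (q - q')"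
    using 1(1) 2(1) by (intro exI[of _ "min e1 e2"] conjI exI[of _ "L1 + L2"]) auto
qed

lemma locally_lipschitz_minus: "locally_lipschitz Y \<Longrightarrow> locally_lipschitz (\<lambda>p. - Y p)"
  unfolding locally_lipschitz_def by (simp add: norm_minus_commute)

lemma solution_continuous_on: "solution Y \<gamma> I \<Longrightarrow> continuous_on I \<gamma>"
  unfolding solution_def continuous_on_eq_continuous_within
  using has_vector_derivative_continuous by blast

lemma solution_subset: "solution Y \<gamma> I \<Longrightarrow> J \<subseteq> I \<Longrightarrow> solution Y \<gamma> J"
  unfolding solution_def by (meson has_vector_derivative_within_subset subsetD)

lemma norm_le_vector_derivative_bound:
  fixes g :: "real \<Rightarrow> 'a::real_normed_vector"
  assumes "\<And>t. t \<in> {a..b} \<Longrightarrow> (g has_vector_derivative g' t) (at t within {a..b})"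
    and "\<And>t. t \<in> {a..b} \<Longrightarrow> norm (g' t) \<le> M" and "s \<in> {a..b}" "t \<in> {a..b}"
  shows "norm (g s - g t) \<le> M * \<bar>s - t\<bar>"
proof -
  have "norm (g s - g t) \<le> M * norm (s - t)"
  proof (rule differentiable_bound[OF convex_real_interval(5)])
    show "(g has_derivative (\<lambda>h. h *\<^sub>R g' x)) (at x within {a..b})" if "x \<in> {a..b}" for x
      using assms(1)[OF that] by (simp add: has_vector_derivative_def)
    show "onorm (\<lambda>h. h *\<^sub>R g' x) \<le> M" if "x \<in> {a..b}" for x
      using assms(2)[OF that] by (simp add: onorm_scaleR_left bounded_linear_ident onorm_id)
  qed fact+
  then show ?thesis by simp
qed

text \<open>Bisection takes the place of Gronwall's inequality: \<open>P a b\<close> says that a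
  zero of the difference at a forces zeros on all of [a, b]. This is transitive over adjacent
  intervals and holds on short intervals around each point, hence on [0, T].\<close>

lemma solution_unique:
  assumes lip: "locally_lipschitz Y" and T: "0 \<le> T"
    and sol1: "solution Y \<gamma>1 {0..T}" and sol2: "solution Y \<gamma>2 {0..T}"
    and init: "\<gamma>1 0 = \<gamma>2 0" and "t \<in> {0..T}"
  shows "\<gamma>1 t = \<gamma>2 t"
proof -
  define g where "g = (\<lambda>t. \<gamma>1 t - \<gamma>2 t)"
  have cont: "continuous_on {0..T} g" "continuous_on {0..T} \<gamma>1" "continuous_on {0..T} \<gamma>2"
    using solution_continuous_on[OF sol1] solution_continuous_on[OF sol2]
    by (auto simp: g_def intro: continuous_intros)
  define P where "P a b \<longleftrightarrow> (0 \<le> a \<longrightarrow> b \<le> T \<longrightarrow> g a = 0 \<longrightarrow> (\<forall>t\<in>{a..b}. g t = 0))" for a b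
  from T have "P 0 T"
  proof (induct rule: Bolzano)
    case (trans a b c)
    then show ?case unfolding P_def by (metis (no_types) atLeastAtMost_iff linear order_trans)
  next
    case (local x)
    then have x: "x \<in> {0..T}" by auto
    show ?case
    proof (cases "g x = 0")
      \<comment> \<open>With g x \<noteq> 0 the premise g a = 0 fails for a close to x, so
        \<open>P a b\<close> holds vacuously.\<close>
      case False
      then obtain d where d: "d > 0" "\<And>t. t \<in> {0..T} \<Longrightarrow> \<bar>t - x\<bar> < d \<Longrightarrow> dist (g t) (g x) < norm (g x)"
        using cont(1) x unfolding continuous_on_iff dist_real_def by (metis zero_less_norm_iff)
      have "P a b" if "a \<le> x" "x \<le> b" "b - a < d" for a b
        unfolding P_def
      proof (intro impI)
        assume "0 \<le> a" "b \<le> T" "g a = 0"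
        then show "\<forall>t\<in>{a..b}. g t = 0" using d(2)[of a] that x by (auto simp: dist_norm)
      qed
      then show ?thesis using d(1) by blast
    next
      case True
      obtain e L0 where e: "e > 0" and L0: "\<And>q q'. q \<in> ball (\<gamma>1 x) e \<Longrightarrow> q' \<in> ball (\<gamma>1 x) e \<Longrightarrow>
          norm (Y q - Y q') \<le> L0 * norm (q - q')"
        using lip unfolding locally_lipschitz_def by meson
      \<comment> \<open>\<open>L0\<close> may be negative; the estimates below multiply by the
        constant monotonically.\<close>
      define L where "L = max L0 0"
      have L: "norm (Y q - Y q') \<le> L * norm (q - q')"
        if "q \<in> ball (\<gamma>1 x) e" "q' \<in> ball (\<gamma>1 x) e" for q q'
        using L0[OF that] mult_right_mono[of L0 L "norm (q - q')"] by (auto simp: L_def)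
      obtain d1 where d1: "d1 > 0" "\<And>t. t \<in> {0..T} \<Longrightarrow> \<bar>t - x\<bar> < d1 \<Longrightarrow> dist (\<gamma>1 t) (\<gamma>1 x) < e"
        using cont(2) x e unfolding continuous_on_iff dist_real_def by metis
      obtain d2 where d2: "d2 > 0" "\<And>t. t \<in> {0..T} \<Longrightarrow> \<bar>t - x\<bar> < d2 \<Longrightarrow> dist (\<gamma>2 t) (\<gamma>2 x) < e"
        using cont(3) x e unfolding continuous_on_iff dist_real_def by metis
      \<comment> \<open>Within d of x both solutions stay in the Lipschitz ball, and d * L \<le> 1 /
        2 makes the estimate below a contraction.\<close>
      define d where "d = min (min d1 d2) (1 / (2 * (L + 1)))"
      have d: "d > 0" "d \<le> d1" "d \<le> d2" "d * L \<le> 1 / 2"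
      proof -
        have "d * (L + 1) \<le> 1 / (2 * (L + 1)) * (L + 1)"
          by (intro mult_right_mono) (auto simp: d_def L_def)
        also have "\<dots> = 1 / 2" by (auto simp: L_def field_simps max_def)
        finally show "d * L \<le> 1 / 2"
          using \<open>d1 > 0\<close> \<open>d2 > 0\<close> by (simp add: algebra_simps d_def L_def min_def max_def split: if_splits)
      qed (use d1 d2 in \<open>auto simp: d_def L_def\<close>)
      have "P a b" if ab: "a \<le> x" "x \<le> b" "b - a < d" for a b
        unfolding P_def
      proof (intro impI)
        assume as: "0 \<le> a" "b \<le> T" "g a = 0"
        have sub: "{a..b} \<subseteq> {0..T}" using as by auto
        have "continuous_on {a..b} (\<lambda>t. norm (g t))"
          by (intro continuous_intros continuous_on_subset[OF cont(1) sub])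
        then obtain c where c: "c \<in> {a..b}" "\<And>t. t \<in> {a..b} \<Longrightarrow> norm (g t) \<le> norm (g c)"
          using continuous_attains_sup[of "{a..b}" "\<lambda>t. norm (g t)"] ab by auto
        \<comment> \<open>At the maximum point c this leads to norm (g c) \<le> norm (g c) / 2, so g
          vanishes at c and hence on all of [a, b].\<close>
        have "norm (g c - g a) \<le> L * norm (g c) * \<bar>c - a\<bar>"
        proof (rule norm_le_vector_derivative_bound)
          fix t assume t: "t \<in> {a..b}"
          show "(g has_vector_derivative Y (\<gamma>1 t) - Y (\<gamma>2 t)) (at t within {a..b})"
            unfolding g_def
            by (intro has_vector_derivative_diff)
               (use solution_subset[OF sol1 sub] solution_subset[OF sol2 sub] t in \<open>auto simp: solution_def\<close>)
          have "\<gamma>1 t \<in> ball (\<gamma>1 x) e" "\<gamma>2 t \<in> ball (\<gamma>1 x) e"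
            using d1(2)[of t] d2(2)[of t] t sub ab d True by (auto simp: dist_commute g_def)
          then have "norm (Y (\<gamma>1 t) - Y (\<gamma>2 t)) \<le> L * norm (g t)"
            using L by (auto simp: g_def)
          also have "\<dots> \<le> L * norm (g c)"
            using c(2)[OF t] by (intro mult_left_mono) (auto simp: L_def)
          finally show "norm (Y (\<gamma>1 t) - Y (\<gamma>2 t)) \<le> L * norm (g c)" .
        qed (use c ab in auto)
        also have "\<dots> \<le> L * norm (g c) * d"
          using c ab by (intro mult_left_mono) (auto simp: L_def)
        also have "\<dots> = (d * L) * norm (g c)" by simp
        also have "\<dots> \<le> 1 / 2 * norm (g c)" by (intro mult_right_mono d) auto
        finally have "norm (g c) = 0" using as by auto
        then show "\<forall>t\<in>{a..b}. g t = 0" using c(2) by auto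
      qed
      then show ?thesis using d(1) by blast
    qed
  qed
  then show ?thesis using init assms(6) by (auto simp: P_def g_def)
qed

section \<open>Holomorphic dependence of solutions on the initial value\<close>

text \<open>The substitution s = a + (t - a) * \<tau> moves the varying upper limit into the
  integrand, leaving an integral over [0, 1] that depends continuously on a parameter. At t = a the
  substitution degenerates and both sides vanish.\<close>

lemma continuous_on_integral_upper:
  fixes g :: "real \<Rightarrow> 'a::topological_space \<Rightarrow> complex"
  assumes "continuous_on ({a..b} \<times> S) (\<lambda>(s, z). g s z)"
  shows "continuous_on ({a..b} \<times> S) (\<lambda>(t, z). integral {a..t} (\<lambda>s. g s z))"
proof -
  define h where "h = (\<lambda>(t, z) \<tau>. g (a + (t - a) * \<tau>) z)"
  have in_ab: "a + (t - a) * \<tau> \<in> {a..b}" if "t \<in> {a..b}" "\<tau> \<in> {0..1}" for t \<tau>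
  proof -
    have "(t - a) * \<tau> \<le> (t - a) * 1" by (rule mult_left_mono) (use that in auto)
    then show ?thesis using that by auto
  qed
  have "continuous_on (({a..b} \<times> S) \<times> cbox 0 1) (\<lambda>p. (\<lambda>(s, z). g s z) (a + (fst (fst p) - a) * snd p, snd (fst p)))"
    by (rule continuous_on_compose2[OF assms], intro continuous_intros) (use in_ab in auto)
  then have "continuous_on (({a..b} \<times> S) \<times> cbox 0 1) (\<lambda>(x, \<tau>). h x \<tau>)"
    by (simp add: h_def case_prod_unfold)
  then have "continuous_on ({a..b} \<times> S) (\<lambda>x. integral (cbox 0 1) (h x))"
    by (rule integral_continuous_on_param)
  then have "continuous_on ({a..b} \<times> S) (\<lambda>x. (fst x - a) *\<^sub>R integral (cbox 0 1) (h x))"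
    by (intro continuous_intros)
  then show ?thesis
  proof (rule continuous_on_eq)
    fix x assume "x \<in> {a..b} \<times> S"
    then obtain t z where x: "x = (t, z)" and t: "t \<in> {a..b}" and z: "z \<in> S" by auto
    show "(fst x - a) *\<^sub>R integral (cbox 0 1) (h x) = (case x of (t, z) \<Rightarrow> integral {a..t} (\<lambda>s. g s z))"
    proof (cases "t = a")
      case False
      with t have ta: "a < t" by auto
      have "continuous_on {a..t} (\<lambda>s. (\<lambda>(s, z). g s z) (s, z))"
        by (rule continuous_on_compose2[OF assms], intro continuous_intros) (use t z in auto)
      then have "((\<lambda>s. g s z) has_integral integral {a..t} (\<lambda>s. g s z)) (cbox a t)"
        by (simp add: integrable_continuous_real integrable_integral)
      from has_integral_affinity'[OF this, of "t - a" a] ta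
      have "((\<lambda>s. g ((t - a) * s + a) z) has_integral (integral {a..t} (\<lambda>s. g s z) /\<^sub>R (t - a))) (cbox 0 1)"
        by simp
      then have "integral (cbox 0 1) (h x) = integral {a..t} (\<lambda>s. g s z) /\<^sub>R (t - a)"
        by (simp add: h_def x add.commute integral_unique)
      then show ?thesis using ta by (simp add: x)
    qed (simp add: x)
  qed
qed

primrec picard :: "(real \<Rightarrow> complex \<Rightarrow> complex) \<Rightarrow> real \<Rightarrow> nat \<Rightarrow> real \<Rightarrow> complex \<Rightarrow> complex" where
  "picard R a 0 = (\<lambda>t z. z)"
| "picard R a (Suc k) = (\<lambda>t z. z + integral {a..t} (\<lambda>s. R s (picard R a k s z)))"

text \<open>\<open>R_0\<close> and the bound on \<open>R'\<close> give |R t w| \<le> L * |w|.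
  Initial values are taken from the ball of half the radius; while |w| \<le> 2 * |z|, the condition
  \<open>small\<close> bounds the integral by 2 * |z| / 4 = |z| / 2, which keeps the iterates inside
  the ball of radius r.\<close>

locale holomorphic_ode =
  fixes R R' :: "real \<Rightarrow> complex \<Rightarrow> complex" and a b r L :: real
  assumes ab: "a \<le> b" and r: "r > 0"
    and cont_R: "continuous_on ({a..b} \<times> ball 0 r) (\<lambda>(t, z). R t z)"
    and cont_R': "continuous_on ({a..b} \<times> ball 0 r) (\<lambda>(t, z). R' t z)"
    and deriv_R: "\<And>t z. t \<in> {a..b} \<Longrightarrow> z \<in> ball 0 r \<Longrightarrow> (R t has_field_derivative R' t z) (at z)"
    and bound_R': "\<And>t z. t \<in> {a..b} \<Longrightarrow> z \<in> ball 0 r \<Longrightarrow> norm (R' t z) \<le> L"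
    and R_0: "\<And>t. t \<in> {a..b} \<Longrightarrow> R t 0 = 0"
    and small: "(b - a) * L \<le> 1 / 4"
begin

abbreviation B where "B \<equiv> ball (0::complex) (r / 2)"
abbreviation u where "u \<equiv> picard R a"

lemma L_nonneg: "0 \<le> L"
  using order_trans[OF norm_ge_zero bound_R'[of a 0]] ab r by auto

lemma lipschitz:
  assumes "t \<in> {a..b}" "z \<in> ball 0 r" "w \<in> ball 0 r"
  shows "norm (R t z - R t w) \<le> L * norm (z - w)"
  by (rule field_differentiable_bound[OF convex_ball[of 0 r]])
     (use assms in \<open>auto intro: DERIV_subset[OF deriv_R] bound_R'\<close>)

lemma continuous_R_comp:
  assumes "continuous_on A f" "continuous_on A g"
    "\<And>p. p \<in> A \<Longrightarrow> f p \<in> {a..b}" "\<And>p. p \<in> A \<Longrightarrow> g p \<in> ball 0 r"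
  shows "continuous_on A (\<lambda>p. R (f p) (g p))" "continuous_on A (\<lambda>p. R' (f p) (g p))"
proof -
  have "continuous_on A (\<lambda>p. (\<lambda>(t, z). R t z) (f p, g p))" "continuous_on A (\<lambda>p. (\<lambda>(t, z). R' t z) (f p, g p))"
    by (rule continuous_on_compose2[OF cont_R] continuous_on_compose2[OF cont_R'];
        use assms in \<open>auto intro: continuous_intros\<close>)+
  then show "continuous_on A (\<lambda>p. R (f p) (g p))" "continuous_on A (\<lambda>p. R' (f p) (g p))" by simp_all
qed

lemma integral_small:
  fixes g :: "real \<Rightarrow> complex"
  assumes "continuous_on {a..b} g" "t \<in> {a..b}" "\<And>s. s \<in> {a..b} \<Longrightarrow> norm (g s) \<le> L * e" "0 \<le> e"
  shows "norm (integral {a..t} g) \<le> e / 4"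
proof -
  have "norm (integral {a..t} g) \<le> L * e * (t - a)"
    by (rule integral_bound) (use assms in \<open>auto intro: continuous_on_subset\<close>)
  also have "\<dots> \<le> L * e * (b - a)"
    using assms L_nonneg by (intro mult_left_mono mult_nonneg_nonneg) auto
  also have "\<dots> = (b - a) * L * e" by simp
  also have "\<dots> \<le> 1 / 4 * e" by (rule mult_right_mono[OF small \<open>0 \<le> e\<close>])
  finally show ?thesis by simp
qed

lemma near_in_ball:
  assumes "z \<in> B" "norm (w - z) \<le> norm z / 2"
  shows "w \<in> ball 0 r" "norm w \<le> 2 * norm z"
proof -
  have "norm z < r / 2" "norm w \<le> norm (w - z) + norm z" "0 \<le> norm z"
    using assms(1) norm_triangle_ineq[of "w - z" z] by auto
  with assms(2) show "w \<in> ball 0 r" "norm w \<le> 2 * norm z"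
    unfolding mem_ball dist_0_norm by linarith+
qed

text \<open>The three properties support each other in the induction: closeness to z keeps the
  iterate in the ball where R is controlled, joint continuity gives integrability, and a jointly
  continuous derivative allows differentiation under the next integral sign.\<close>

lemma picard_invariant:
  "continuous_on ({a..b} \<times> B) (\<lambda>(t, z). u k t z) \<and>
   (\<forall>t\<in>{a..b}. \<forall>z\<in>B. norm (u k t z - z) \<le> norm z / 2) \<and>
   (\<exists>v. continuous_on ({a..b} \<times> B) (\<lambda>(t, z). v t z) \<and>
      (\<forall>t\<in>{a..b}. \<forall>z\<in>B. (u k t has_field_derivative v t z) (at z)))"
proof (induction k)
  case 0
  have "continuous_on ({a..b} \<times> B) (\<lambda>(t, z). (\<lambda>_ _. 1) t z)" by (simp add: case_prod_unfold)
  moreover have "continuous_on ({a..b} \<times> B) (\<lambda>(t, z). z)"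
    unfolding case_prod_unfold by (intro continuous_intros)
  moreover have "((\<lambda>z. z) has_field_derivative 1) (at z)" for z :: complex
    by (rule DERIV_ident)
  ultimately show ?case by (auto intro!: exI[of _ "\<lambda>_ _. 1"])
next
  case (Suc k)
  then obtain v where cont_u: "continuous_on ({a..b} \<times> B) (\<lambda>(t, z). u k t z)"
    and near: "\<And>t z. t \<in> {a..b} \<Longrightarrow> z \<in> B \<Longrightarrow> norm (u k t z - z) \<le> norm z / 2"
    and cont_v: "continuous_on ({a..b} \<times> B) (\<lambda>(t, z). v t z)"
    and deriv_u: "\<And>t z. t \<in> {a..b} \<Longrightarrow> z \<in> B \<Longrightarrow> (u k t has_field_derivative v t z) (at z)"
    by blast
  note in_ball = near_in_ball[OF _ near]
  \<comment> \<open>The derivative in z of the next iterate, by the Leibniz rule and the chain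
    rule.\<close>
  define v' where "v' t z = 1 + integral {a..t} (\<lambda>s. R' s (u k s z) * v s z)" for t z
  have cR: "continuous_on ({a..b} \<times> B) (\<lambda>(t, z). R t (u k t z))"
    and cR': "continuous_on ({a..b} \<times> B) (\<lambda>(t, z). R' t (u k t z) * v t z)"
    using cont_u cont_v in_ball(1) unfolding case_prod_unfold
    by (intro continuous_intros continuous_R_comp; auto)+
  have cRt: "continuous_on {a..b} (\<lambda>s. R s (u k s z))" if "z \<in> B" for z
  proof -
    have "continuous_on {a..b} (\<lambda>s. (\<lambda>(t, z). R t (u k t z)) (s, z))"
      by (rule continuous_on_compose2[OF cR]) (use that in \<open>auto intro!: continuous_intros\<close>)
    then show ?thesis by simp
  qed
  have "continuous_on ({a..b} \<times> B) (\<lambda>p. snd p + (\<lambda>(t, z). integral {a..t} (\<lambda>s. R s (u k s z))) p)"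
    by (intro continuous_intros continuous_on_integral_upper cR)
  then have 1: "continuous_on ({a..b} \<times> B) (\<lambda>(t, z). u (Suc k) t z)"
    by (simp add: case_prod_unfold)
  have "continuous_on ({a..b} \<times> B) (\<lambda>p. 1 + (\<lambda>(t, z). integral {a..t} (\<lambda>s. R' s (u k s z) * v s z)) p)"
    by (intro continuous_intros continuous_on_integral_upper cR')
  then have 2: "continuous_on ({a..b} \<times> B) (\<lambda>(t, z). v' t z)"
    by (simp add: case_prod_unfold v'_def)
  have 3: "norm (u (Suc k) t z - z) \<le> norm z / 2" if "t \<in> {a..b}" "z \<in> B" for t z
  proof -
    have "norm (integral {a..t} (\<lambda>s. R s (u k s z))) \<le> (2 * norm z) / 4"
    proof (rule integral_small[OF cRt[OF that(2)] that(1)])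
      fix s assume s: "s \<in> {a..b}"
      have "norm (R s (u k s z)) \<le> L * norm (u k s z)"
        using lipschitz[OF s in_ball(1)[OF that(2) s that(2)], of 0] r R_0[OF s] by simp
      also have "\<dots> \<le> L * (2 * norm z)"
        by (rule mult_left_mono[OF in_ball(2)[OF that(2) s that(2)] L_nonneg])
      finally show "norm (R s (u k s z)) \<le> L * (2 * norm z)" .
    qed auto
    then show ?thesis by simp
  qed
  have 4: "(u (Suc k) t has_field_derivative v' t z) (at z)" if t: "t \<in> {a..b}" and z: "z \<in> B" for t z
  proof -
    have "((\<lambda>z. integral (cbox a t) (\<lambda>s. R s (u k s z))) has_field_derivative
        integral (cbox a t) (\<lambda>s. R' s (u k s z) * v s z)) (at z within B)"
    proof (rule leibniz_rule_field_derivative[OF _ _ _ z convex_ball])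
      fix z s assume z: "z \<in> B" and s: "s \<in> cbox a t"
      have s': "s \<in> {a..b}" using s t by auto
      have "((\<lambda>z. R s (u k s z)) has_field_derivative R' s (u k s z) * v s z) (at z)"
        by (rule DERIV_chain2[OF deriv_R deriv_u]) (use z s' in_ball(1)[OF z s' z] in auto)
      then show "((\<lambda>z. R s (u k s z)) has_field_derivative R' s (u k s z) * v s z) (at z within B)"
        by (rule has_field_derivative_at_within)
    next
      fix z assume "z \<in> B"
      then show "(\<lambda>s. R s (u k s z)) integrable_on cbox a t"
        using t by (auto intro!: integrable_continuous_real continuous_on_subset[OF cRt])
    next
      have "continuous_on (B \<times> cbox a t) (\<lambda>p. (\<lambda>(t, z). R' t (u k t z) * v t z) (snd p, fst p))"
        by (rule continuous_on_compose2[OF cR']) (use t in \<open>auto intro!: continuous_intros\<close>)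
      then show "continuous_on (B \<times> cbox a t) (\<lambda>(z, s). R' s (u k s z) * v s z)"
        by (simp add: case_prod_unfold)
    qed
    then have "((\<lambda>z. integral {a..t} (\<lambda>s. R s (u k s z))) has_field_derivative
        integral {a..t} (\<lambda>s. R' s (u k s z) * v s z)) (at z)"
      using z by (simp add: at_within_open[OF _ open_ball])
    then show ?thesis
      by (auto simp: v'_def intro!: derivative_eq_intros)
  qed
  show ?case using 1 2 3 4 by blast
qed

lemma picard_near: "t \<in> {a..b} \<Longrightarrow> z \<in> B \<Longrightarrow> norm (u k t z - z) \<le> norm z / 2"
  using picard_invariant[of k] by blast

lemma picard_in_ball: "t \<in> {a..b} \<Longrightarrow> z \<in> B \<Longrightarrow> u k t z \<in> ball 0 r"
  using near_in_ball picard_near by blast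

lemma continuous_on_picard: "continuous_on ({a..b} \<times> B) (\<lambda>(t, z). u k t z)"
  using picard_invariant[of k] by blast

lemma continuous_on_R_picard:
  assumes "z \<in> B"
  shows "continuous_on {a..b} (\<lambda>s. R s (u k s z))"
proof (rule continuous_R_comp)
  show "continuous_on {a..b} (\<lambda>s. u k s z)"
  proof -
    have "continuous_on {a..b} (\<lambda>s. (\<lambda>(t, z). u k t z) (s, z))"
      by (rule continuous_on_compose2[OF continuous_on_picard]) (use assms in \<open>auto intro!: continuous_intros\<close>)
    then show ?thesis by simp
  qed
qed (use assms picard_in_ball in \<open>auto intro: continuous_intros\<close>)

text \<open>Each iteration gains the factor (b - a) * L \<le> 1 / 4, and the first step is at most
  |z| / 2 < r.\<close>

lemma picard_contraction:
  assumes "t \<in> {a..b}" "z \<in> B"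
  shows "norm (u (Suc k) t z - u k t z) \<le> r * (1 / 4) ^ k"
  using assms(1)
proof (induction k arbitrary: t)
  case 0
  have "norm (u 1 t z - z) \<le> norm z / 2" "norm z < r / 2" "0 \<le> norm z"
    using picard_near[OF 0 assms(2), of 1] assms(2) by auto
  then have "norm (u 1 t z - z) \<le> r" by linarith
  then show ?case by simp
next
  case (Suc k)
  have "u (Suc (Suc k)) t z - u (Suc k) t z =
      integral {a..t} (\<lambda>s. R s (u (Suc k) s z) - R s (u k s z))"
    unfolding picard.simps(2)[of R a "Suc k"] picard.simps(2)[of R a k, THEN fun_cong, THEN fun_cong, of t z]
    by (subst Henstock_Kurzweil_Integration.integral_diff)
       (use Suc.prems in \<open>auto intro!: integrable_continuous_real continuous_on_subset[OF continuous_on_R_picard[OF assms(2)]] simp del: picard.simps\<close>)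
  also have "norm \<dots> \<le> r * (1 / 4) ^ k / 4"
  proof (rule integral_small)
    show "continuous_on {a..b} (\<lambda>s. R s (u (Suc k) s z) - R s (u k s z))"
      by (intro continuous_intros continuous_on_R_picard assms)
    fix s assume s: "s \<in> {a..b}"
    show "norm (R s (u (Suc k) s z) - R s (u k s z)) \<le> L * (r * (1 / 4) ^ k)"
      by (rule order_trans[OF lipschitz[OF s picard_in_ball picard_in_ball] mult_left_mono[OF Suc.IH[OF s] L_nonneg]])
         (use s assms in auto)
  qed (use Suc.prems r in auto)
  finally show ?case by (simp del: picard.simps)
qed

text \<open>The telescoping form turns convergence of the iterates into that of a series with the
  geometric majorant \<open>r * (1 / 4) ^ k\<close>.\<close>

definition U :: "real \<Rightarrow> complex \<Rightarrow> complex" where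
  "U t z = z + (\<Sum>k. u (Suc k) t z - u k t z)"

lemma uniform_limit_picard:
  "uniform_limit ({a..b} \<times> B) (\<lambda>n (t, z). u n t z) (\<lambda>(t, z). U t z) sequentially"
proof -
  have "uniform_limit ({a..b} \<times> B) (\<lambda>n p. \<Sum>k<n. u (Suc k) (fst p) (snd p) - u k (fst p) (snd p))
      (\<lambda>p. \<Sum>k. u (Suc k) (fst p) (snd p) - u k (fst p) (snd p)) sequentially"
    by (rule Weierstrass_m_test[of _ _ "\<lambda>k. r * (1 / 4) ^ k"])
       (auto intro!: picard_contraction summable_mult summable_geometric simp del: picard.simps)
  then have "uniform_limit ({a..b} \<times> B) (\<lambda>n p. snd p + (\<Sum>k<n. u (Suc k) (fst p) (snd p) - u k (fst p) (snd p)))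
      (\<lambda>p. snd p + (\<Sum>k. u (Suc k) (fst p) (snd p) - u k (fst p) (snd p))) sequentially"
    by (intro uniform_limit_intros)
  then show ?thesis
    unfolding sum_lessThan_telescope[of "\<lambda>k. u k t z" for t z] U_def case_prod_unfold by simp
qed

lemma picard_tendsto:
  assumes "t \<in> {a..b}" "z \<in> B"
  shows "(\<lambda>n. u n t z) \<longlonglongrightarrow> U t z"
  using tendsto_uniform_limitI[OF uniform_limit_picard, of "(t, z)"] assms by simp

text \<open>The closed bound on the iterates survives the limit. It forces U t 0 = 0 and keeps a
  real solution from x > 0 between x / 2 and 3 * x / 2.\<close>

lemma U_near: "t \<in> {a..b} \<Longrightarrow> z \<in> B \<Longrightarrow> norm (U t z - z) \<le> norm z / 2"
proof (rule Lim_norm_ubound[OF _ tendsto_diff[OF picard_tendsto tendsto_const]])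
  assume "t \<in> {a..b}" "z \<in> B"
  then show "\<forall>\<^sub>F n in sequentially. norm (u n t z - z) \<le> norm z / 2"
    using picard_near by (simp add: always_eventually)
qed auto

lemma U_0: "t \<in> {a..b} \<Longrightarrow> U t 0 = 0"
  using U_near[of t 0] r by simp

lemma U_holomorphic:
  assumes t: "t \<in> {a..b}"
  shows "U t holomorphic_on B"
proof (rule holomorphic_uniform_sequence[OF open_ball])
  show "u n t holomorphic_on B" for n
    using picard_invariant[of n] t unfolding holomorphic_on_def field_differentiable_def
    by (meson has_field_derivative_at_within)
  fix z assume z: "z \<in> B"
  obtain d where d: "d > 0" "cball z d \<subseteq> B"
    using open_contains_cball[of B] z open_ball by metis
  have "uniform_limit (cball z d) (\<lambda>n. u n t) (U t) sequentially"
    unfolding uniform_limit_iff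
  proof (intro allI impI)
    fix e :: real assume "e > 0"
    with uniform_limit_picard have "\<forall>\<^sub>F n in sequentially. \<forall>p\<in>{a..b} \<times> B.
        dist ((\<lambda>(t, z). u n t z) p) ((\<lambda>(t, z). U t z) p) < e"
      unfolding uniform_limit_iff by blast
    then show "\<forall>\<^sub>F n in sequentially. \<forall>x\<in>cball z d. dist (u n t x) (U t x) < e"
      by (rule eventually_mono) (use t d in auto)
  qed
  then show "\<exists>d>0. cball z d \<subseteq> B \<and> uniform_limit (cball z d) (\<lambda>n. u n t) (U t) sequentially"
    using d by blast
qed

lemma continuous_on_R_U:
  assumes z: "z \<in> B"
  shows "continuous_on {a..b} (\<lambda>s. R s (U s z))"
proof (rule continuous_R_comp)
  have "continuous_on ({a..b} \<times> B) (\<lambda>(t, z). U t z)"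
    by (rule uniform_limit_theorem[OF _ uniform_limit_picard])
       (auto intro!: always_eventually continuous_on_picard simp del: picard.simps)
  then have "continuous_on {a..b} (\<lambda>s. (\<lambda>(t, z). U t z) (s, z))"
    by (rule continuous_on_compose2) (use z in \<open>auto intro!: continuous_intros\<close>)
  then show "continuous_on {a..b} (\<lambda>s. U s z)" by simp
qed (use near_in_ball(1)[OF z] U_near z in \<open>auto intro: continuous_intros\<close>)

text \<open>The limit of the Picard recursion: the Lipschitz bound carries uniform convergence over
  to the integrands, and \<open>integral_small\<close> turns an integrand bound L * e into e / 4 <
  e.\<close>

lemma U_integral_equation:
  assumes t: "t \<in> {a..b}" and z: "z \<in> B"
  shows "U t z = z + integral {a..t} (\<lambda>s. R s (U s z))"
proof (rule LIMSEQ_unique)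
  show "(\<lambda>n. u (Suc n) t z) \<longlonglongrightarrow> U t z"
    by (rule LIMSEQ_Suc[OF picard_tendsto[OF assms]])
  have "(\<lambda>n. integral {a..t} (\<lambda>s. R s (u n s z))) \<longlonglongrightarrow> integral {a..t} (\<lambda>s. R s (U s z))"
  proof (rule tendstoI)
    fix e :: real assume "e > 0"
    with uniform_limit_picard have "\<forall>\<^sub>F n in sequentially. \<forall>p\<in>{a..b} \<times> B.
        dist ((\<lambda>(t, z). u n t z) p) ((\<lambda>(t, z). U t z) p) < e"
      unfolding uniform_limit_iff by blast
    then show "\<forall>\<^sub>F n in sequentially.
        dist (integral {a..t} (\<lambda>s. R s (u n s z))) (integral {a..t} (\<lambda>s. R s (U s z))) < e"
    proof (rule eventually_mono)
      fix n assume n: "\<forall>p\<in>{a..b} \<times> B. dist ((\<lambda>(t, z). u n t z) p) ((\<lambda>(t, z). U t z) p) < e"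
      have "integral {a..t} (\<lambda>s. R s (u n s z)) - integral {a..t} (\<lambda>s. R s (U s z)) =
          integral {a..t} (\<lambda>s. R s (u n s z) - R s (U s z))"
        by (subst Henstock_Kurzweil_Integration.integral_diff)
           (use t in \<open>auto intro!: integrable_continuous_real continuous_on_subset[OF continuous_on_R_picard[OF z]]
              continuous_on_subset[OF continuous_on_R_U[OF z]]\<close>)
      also have "norm \<dots> \<le> e / 4"
      proof (rule integral_small[OF _ t])
        show "continuous_on {a..b} (\<lambda>s. R s (u n s z) - R s (U s z))"
          by (intro continuous_intros continuous_on_R_picard continuous_on_R_U z)
        fix s assume s: "s \<in> {a..b}"
        have "norm (R s (u n s z) - R s (U s z)) \<le> L * norm (u n s z - U s z)"
          by (rule lipschitz[OF s picard_in_ball[OF s z] near_in_ball(1)[OF z U_near[OF s z]]])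
        also have "\<dots> \<le> L * e"
          using bspec[OF n, of "(s, z)"] s z by (intro mult_left_mono L_nonneg) (simp add: dist_norm)
        finally show "norm (R s (u n s z) - R s (U s z)) \<le> L * e" .
      qed (use \<open>e > 0\<close> in auto)
      finally show "dist (integral {a..t} (\<lambda>s. R s (u n s z))) (integral {a..t} (\<lambda>s. R s (U s z))) < e"
        using \<open>e > 0\<close> by (simp add: dist_norm)
    qed
  qed
  then have "(\<lambda>n. z + integral {a..t} (\<lambda>s. R s (u n s z))) \<longlonglongrightarrow> z + integral {a..t} (\<lambda>s. R s (U s z))"
    by (intro tendsto_intros)
  then show "(\<lambda>n. u (Suc n) t z) \<longlonglongrightarrow> z + integral {a..t} (\<lambda>s. R s (U s z))" by simp
qed

lemma U_initial: "z \<in> B \<Longrightarrow> U a z = z"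
  using U_integral_equation[of a z] ab by simp

lemma U_solution:
  assumes t: "t \<in> {a..b}" and z: "z \<in> B"
  shows "((\<lambda>t. U t z) has_vector_derivative R t (U t z)) (at t within {a..b})"
proof -
  have "((\<lambda>t. z + integral {a..t} (\<lambda>s. R s (U s z))) has_vector_derivative 0 + R t (U t z)) (at t within {a..b})"
    by (intro has_vector_derivative_add has_vector_derivative_const
        integral_has_vector_derivative continuous_on_R_U z t)
  then show ?thesis
    using has_vector_derivative_transform[OF t U_integral_equation[OF _ z]] by simp
qed

text \<open>Each iterate from a real initial value is real, because the imaginary part of the
  integrand vanishes; the real line is closed, so the limit is real too.\<close>

lemma U_real:
  assumes real_R: "\<And>t x. t \<in> {a..b} \<Longrightarrow> \<bar>x\<bar> < r \<Longrightarrow> R t (of_real x) \<in> \<real>"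
    and t: "t \<in> {a..b}" and x: "\<bar>x\<bar> < r / 2"
  shows "U t (of_real x) \<in> \<real>"
proof (rule Lim_in_closed_set[OF closed_complex_Reals _ sequentially_bot picard_tendsto])
  have z: "complex_of_real x \<in> B" using x by simp
  have "u n t (of_real x) \<in> \<real>" if "t \<in> {a..b}" for n t
    using that
  proof (induction n arbitrary: t)
    case (Suc n)
    have "Im (R s (u n s (of_real x))) = 0" if s: "s \<in> {a..b}" for s
    proof -
      obtain y where "u n s (of_real x) = of_real y" using Suc.IH[OF s] by (blast elim: Reals_cases)
      moreover then have "\<bar>y\<bar> < r" using picard_in_ball[OF s z, of n] by simp
      ultimately show ?thesis using real_R[OF s, of y] by (simp add: complex_is_Real_iff)
    qed
    then have "integral {a..t} (Im \<circ> (\<lambda>s. R s (u n s (of_real x)))) = integral {a..t} (\<lambda>_. 0)"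
      by (intro Henstock_Kurzweil_Integration.integral_cong) (use Suc.prems in auto)
    moreover have "integral {a..t} (Im \<circ> (\<lambda>s. R s (u n s (of_real x)))) =
        Im (integral {a..t} (\<lambda>s. R s (u n s (of_real x))))"
      by (rule integral_linear[OF _ bounded_linear_Im])
         (use Suc.prems in \<open>auto intro!: integrable_continuous_real continuous_on_subset[OF continuous_on_R_picard[OF z]]\<close>)
    ultimately show ?case by (simp add: complex_is_Real_iff)
  qed simp
  then show "\<forall>\<^sub>F n in sequentially. u n t (of_real x) \<in> \<real>" using t by (simp add: always_eventually)
qed (use t x in auto)

end

section \<open>Analytic flow of the polar equation\<close>

lemma biseries_conv_of_real:
  "biseries_conv c r \<Longrightarrow> biseries_conv (\<lambda>m n. complex_of_real (c m n)) r"
  unfolding biseries_conv_def by simp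

lemma biseries_of_real:
  assumes "biseries_conv c r" "\<bar>x\<bar> < r" "\<bar>y\<bar> < r"
  shows "biseries (\<lambda>m n. complex_of_real (c m n)) (of_real x) (of_real y) = of_real (biseries c x y)"
proof -
  have "((\<lambda>p. complex_of_real ((\<lambda>(m, n). c m n * x ^ m * y ^ n) p)) has_sum of_real (biseries c x y)) UNIV"
    by (rule has_sum_of_real, rule biseries_has_sum) (use assms in auto)
  then show ?thesis
    unfolding biseries_def[of "\<lambda>m n. complex_of_real (c m n)"]
    by (intro infsumI) (simp add: case_prod_unfold)
qed

text \<open>The interface to \<open>holomorphic_ode\<close>: near t0 the real right-hand side K
  extends to a complex second argument with the properties of that locale, except for the length of
  the interval, which is chosen later.\<close>

definition complexifiable :: "(real \<Rightarrow> real \<Rightarrow> real) \<Rightarrow> real \<Rightarrow> bool" where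
  "complexifiable K t0 \<longleftrightarrow> (\<exists>d>0. \<exists>R R' L.
     continuous_on ({t0 - d..t0 + d} \<times> ball 0 d) (\<lambda>(t, z). R t z) \<and>
     continuous_on ({t0 - d..t0 + d} \<times> ball 0 d) (\<lambda>(t, z). R' t z) \<and>
     (\<forall>t\<in>{t0 - d..t0 + d}. R t 0 = 0 \<and>
        (\<forall>z\<in>ball 0 d. (R t has_field_derivative R' t z) (at z) \<and> norm (R' t z) \<le> L) \<and>
        (\<forall>x. \<bar>x\<bar> < d \<longrightarrow> R t (complex_of_real x) = of_real (K t x))))"

lemma biseries_complex_extension:
  assumes "real_analytic_on F S" "(\<theta>, 0) \<in> S"
  obtains r H H' where "r > 0" "continuous_on (ball 0 r \<times> ball 0 r) (\<lambda>(x, z). H x z)"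
    "continuous_on (ball 0 r \<times> ball 0 r) (\<lambda>(x, z). H' x z)"
    "\<And>x z. x \<in> ball 0 r \<Longrightarrow> z \<in> ball 0 r \<Longrightarrow> (H x has_field_derivative H' x z) (at z)"
    "\<And>x y. \<bar>x\<bar> < r \<Longrightarrow> \<bar>y\<bar> < r \<Longrightarrow> H (complex_of_real x) (of_real y) = complex_of_real (F (\<theta> + x, y))"
proof -
  obtain r c where r: "r > 0" and c: "biseries_conv c r"
    and F: "\<And>x y. \<bar>x\<bar> < r \<Longrightarrow> \<bar>y\<bar> < r \<Longrightarrow> F (\<theta> + x, 0 + y) = biseries c x y"
    using real_analytic_on_biseries[OF assms] by blast
  define c' where "c' = (\<lambda>m n. complex_of_real (c m n))"
  have c': "biseries_conv c' r" unfolding c'_def by (rule biseries_conv_of_real[OF c])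
  obtain c'' where c'': "biseries_conv c'' r" and d: "\<And>x z. norm x < r \<Longrightarrow> norm z < r \<Longrightarrow>
      (biseries c' x has_field_derivative biseries c'' x z) (at z)"
    using biseries_deriv_snd[OF c'] by blast
  show thesis
  proof (rule that[of r "biseries c'" "biseries c''"])
    show "biseries c' (complex_of_real x) (of_real y) = complex_of_real (F (\<theta> + x, y))"
      if "\<bar>x\<bar> < r" "\<bar>y\<bar> < r" for x y
      using biseries_of_real[OF c that] F[OF that] by (simp add: c'_def)
  qed (use r d biseries_continuous_on[OF c'] biseries_continuous_on[OF c''] in auto)
qed

text \<open>G is nonzero at the base point, hence by continuity on a small complex bidisc, where the
  quotient of the extensions is holomorphic in z. The angle \<theta>0 + \<sigma> * t lets a sector
  be swept in either direction; the outer \<sigma> is the chain rule factor.\<close>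

lemma complexifiable_quotient:
  assumes F: "real_analytic_on F (UNIV \<times> {0})" and G: "real_analytic_on G (UNIV \<times> {0})"
    and F0: "\<And>\<theta>. F (\<theta>, 0) = 0" and G0: "G (\<theta>0 + \<sigma> * t0, 0) \<noteq> 0" and \<sigma>: "\<bar>\<sigma>\<bar> = 1"
  shows "complexifiable (\<lambda>t x. \<sigma> * (F (\<theta>0 + \<sigma> * t, x) / G (\<theta>0 + \<sigma> * t, x))) t0"
proof -
  define \<theta> where "\<theta> = \<theta>0 + \<sigma> * t0"
  obtain r1 f f' where f: "r1 > 0" "continuous_on (ball 0 r1 \<times> ball 0 r1) (\<lambda>(x, z). f x z)"
    "continuous_on (ball 0 r1 \<times> ball 0 r1) (\<lambda>(x, z). f' x z)"
    "\<And>x z. x \<in> ball 0 r1 \<Longrightarrow> z \<in> ball 0 r1 \<Longrightarrow> (f x has_field_derivative f' x z) (at z)"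
    "\<And>x y. \<bar>x\<bar> < r1 \<Longrightarrow> \<bar>y\<bar> < r1 \<Longrightarrow> f (complex_of_real x) (of_real y) = complex_of_real (F (\<theta> + x, y))"
    using biseries_complex_extension[OF F, of \<theta>] by auto
  obtain r2 g g' where g: "r2 > 0" "continuous_on (ball 0 r2 \<times> ball 0 r2) (\<lambda>(x, z). g x z)"
    "continuous_on (ball 0 r2 \<times> ball 0 r2) (\<lambda>(x, z). g' x z)"
    "\<And>x z. x \<in> ball 0 r2 \<Longrightarrow> z \<in> ball 0 r2 \<Longrightarrow> (g x has_field_derivative g' x z) (at z)"
    "\<And>x y. \<bar>x\<bar> < r2 \<Longrightarrow> \<bar>y\<bar> < r2 \<Longrightarrow> g (complex_of_real x) (of_real y) = complex_of_real (G (\<theta> + x, y))"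
    using biseries_complex_extension[OF G, of \<theta>] by auto
  have "isCont (\<lambda>(x, z). g x z) (0, 0)"
    using g(1,2) by (subst (asm) continuous_on_eq_continuous_at) (auto intro: open_Times)
  moreover have "g 0 0 \<noteq> 0" using g(5)[of 0 0] g(1) G0 by (simp add: \<theta>_def)
  ultimately obtain e where e: "e > 0" "\<And>p. dist p (0, 0) < e \<Longrightarrow> (\<lambda>(x, z). g x z) p \<noteq> 0"
    unfolding continuous_at_eps_delta
    by (smt (verit) case_prod_conv dist_0_norm dist_commute dist_not_less_zero dist_pos_lt)
  \<comment> \<open>The divisor 3 gives norm (X t) + norm z \<le> 2 * d < e, which keeps the
    denominator nonzero, as well as d < r1 and d < r2.\<close>
  define d where "d = min e (min r1 r2) / 3"
  have d: "d > 0" "d < r1" "d < r2" "2 * d < e"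
    using e(1) f(1) g(1) by (auto simp: d_def min_def)
  define I where "I = {t0 - d..t0 + d}"
  \<comment> \<open>The angle at time t measured from the centre \<theta> of both
    expansions.\<close>
  define X where "X t = complex_of_real (\<sigma> * (t - t0))" for t
  have X: "X t \<in> ball 0 r1" "X t \<in> ball 0 r2" "norm (X t) \<le> d" if "t \<in> I" for t
    using that \<sigma> d by (auto simp: X_def I_def abs_mult norm_mult abs_le_iff simp flip: of_real_diff)
  have gnz: "g (X t) z \<noteq> 0" if "t \<in> I" "z \<in> cball 0 d" for t z
  proof -
    have "norm (X t, z) \<le> norm (X t) + norm z" by (rule norm_Pair_le)
    also have "\<dots> < e" using X(3)[OF that(1)] that(2) d by auto
    finally show ?thesis using e(2)[of "(X t, z)"] by (simp add: dist_norm)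
  qed
  have comp: "continuous_on (I \<times> cball 0 d) (\<lambda>p. h (X (fst p)) (snd p))"
    if "continuous_on (ball 0 r' \<times> ball 0 r') (\<lambda>(x, z). h x z)" "r' \<in> {r1, r2}" for h :: "complex \<Rightarrow> complex \<Rightarrow> complex" and r'
  proof -
    have "continuous_on (I \<times> cball 0 d) (\<lambda>p. (\<lambda>(x, z). h x z) (X (fst p), snd p))"
      by (rule continuous_on_compose2[OF that(1)])
         (use that(2) X d in \<open>auto simp: X_def intro!: continuous_intros\<close>)
    then show ?thesis by simp
  qed
  note conts = comp[OF f(2)] comp[OF f(3)] comp[OF g(2)] comp[OF g(3)]
  define R where "R t z = of_real \<sigma> * (f (X t) z / g (X t) z)" for t z
  define R' where "R' t z = of_real \<sigma> * ((f' (X t) z * g (X t) z - f (X t) z * g' (X t) z) / (g (X t) z * g (X t) z))" for t z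
  have cR: "continuous_on (I \<times> cball 0 d) (\<lambda>(t, z). R t z)"
    unfolding R_def case_prod_unfold
    by (intro continuous_intros conts) (use gnz in auto)
  have cR': "continuous_on (I \<times> cball 0 d) (\<lambda>(t, z). R' t z)"
    unfolding R'_def case_prod_unfold
    by (intro continuous_intros conts) (use gnz in auto)
  \<comment> \<open>The common bound for R' comes from compactness, which is why continuity was
    established on the closed disc.\<close>
  have "compact ((\<lambda>(t, z). R' t z) ` (I \<times> cball 0 d))"
    by (intro compact_continuous_image cR' compact_Times) (auto simp: I_def)
  then obtain L where L: "\<And>p. p \<in> I \<times> cball 0 d \<Longrightarrow> norm ((\<lambda>(t, z). R' t z) p) \<le> L"
    by (meson compact_imp_bounded bounded_iff imageI)
  have "R t 0 = 0 \<and>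
        (\<forall>z\<in>ball 0 d. (R t has_field_derivative R' t z) (at z) \<and> norm (R' t z) \<le> L) \<and>
        (\<forall>x. \<bar>x\<bar> < d \<longrightarrow> R t (complex_of_real x) = of_real (\<sigma> * (F (\<theta>0 + \<sigma> * t, x) / G (\<theta>0 + \<sigma> * t, x))))"
    if t: "t \<in> I" for t
  proof (intro conjI ballI allI impI)
    have Xt: "\<bar>\<sigma> * (t - t0)\<bar> < r1" "\<bar>\<sigma> * (t - t0)\<bar> < r2"
      using X(1,2)[OF t] by (simp_all only: X_def mem_ball dist_0_norm norm_of_real)
    have \<theta>t: "\<theta> + \<sigma> * (t - t0) = \<theta>0 + \<sigma> * t" by (simp add: \<theta>_def algebra_simps)
    show *: "R t (complex_of_real x) = of_real (\<sigma> * (F (\<theta>0 + \<sigma> * t, x) / G (\<theta>0 + \<sigma> * t, x)))"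
      if "\<bar>x\<bar> < d" for x
      using f(5)[OF Xt(1), of x] g(5)[OF Xt(2), of x] that d unfolding R_def X_def \<theta>t by simp
    show "R t 0 = 0" using *[of 0] d F0 by simp
    fix z :: complex assume z: "z \<in> ball 0 d"
    show "norm (R' t z) \<le> L" using L[of "(t, z)"] t z by auto
    have "(f (X t) has_field_derivative f' (X t) z) (at z)" "(g (X t) has_field_derivative g' (X t) z) (at z)"
      using f(4)[OF X(1)[OF t]] g(4)[OF X(2)[OF t]] z d by auto
    then show "(R t has_field_derivative R' t z) (at z)"
      unfolding R_def R'_def by (intro DERIV_cmult DERIV_divide) (use gnz[OF t] z in auto)
  qed
  moreover have "continuous_on (I \<times> ball 0 d) (\<lambda>(t, z). R t z)" "continuous_on (I \<times> ball 0 d) (\<lambda>(t, z). R' t z)"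
    by (rule continuous_on_subset[OF cR] continuous_on_subset[OF cR']; auto)+
  ultimately show ?thesis
    using d(1) unfolding complexifiable_def I_def by blast
qed

text \<open>P is the transition map from a to b, kept as a complex analytic germ at 0 but tied to
  the equation through real solutions with positive initial value. The bounds 0 < \<rho> t <
  \<delta> are those under which the polar equivalence applies.\<close>

definition analytic_flow :: "(real \<Rightarrow> real \<Rightarrow> real) \<Rightarrow> real \<Rightarrow> real \<Rightarrow> real \<Rightarrow> bool" where
  "analytic_flow K \<delta> a b \<longleftrightarrow> (\<exists>P. \<exists>\<epsilon>>0. P analytic_on {0} \<and> P 0 = 0 \<and>
     (\<forall>x\<in>{0<..<\<epsilon>}. \<exists>\<rho>. \<rho> a = x \<and> P (complex_of_real x) = of_real (\<rho> b) \<and>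
        (\<forall>t\<in>{a..b}. 0 < \<rho> t \<and> \<rho> t < \<delta> \<and> (\<rho> has_real_derivative K t (\<rho> t)) (at t within {a..b}))))"

lemma has_real_derivative_concat:
  assumes "\<rho>1 b = \<rho>2 b" and "t \<in> {a..c}" and "a \<le> b" "b \<le> c"
    and d1: "t \<le> b \<Longrightarrow> (\<rho>1 has_real_derivative D) (at t within {a..b})"
    and d2: "b \<le> t \<Longrightarrow> (\<rho>2 has_real_derivative D) (at t within {b..c})"
  shows "((\<lambda>t. if t \<le> b then \<rho>1 t else \<rho>2 t) has_real_derivative D) (at t within {a..c})"
proof -
  let ?\<rho> = "\<lambda>t. if t \<le> b then \<rho>1 t else \<rho>2 t"
  have "(?\<rho> has_real_derivative D) (at t within {a..b})"
  proof (cases "t \<le> b")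
    case True
    then show ?thesis
      using d1[OF True] assms(2)
      by (intro has_field_derivative_transform_within[OF d1[OF True] zero_less_one]) auto
  next
    case False
    then have "at t within {a..b} = bot" by (simp add: at_within_eq_bot_iff)
    then show ?thesis by (simp add: has_field_derivative_iff)
  qed
  moreover have "(?\<rho> has_real_derivative D) (at t within {b..c})"
  proof (cases "b \<le> t")
    case True
    then show ?thesis
      using assms(1,2)
      by (intro has_field_derivative_transform_within[OF d2[OF True] zero_less_one]) auto
  next
    case False
    then have "at t within {b..c} = bot" by (simp add: at_within_eq_bot_iff)
    then show ?thesis by (simp add: has_field_derivative_iff)
  qed
  moreover have "{a..c} = {a..b} \<union> {b..c}" using assms by auto
  ultimately show ?thesis
    by (simp add: has_field_derivative_iff Lim_within_Un)
qed

lemma analytic_flow_trans: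
  assumes 1: "analytic_flow K \<delta> a b" and 2: "analytic_flow K \<delta> b c" and "a \<le> b" "b \<le> c"
  shows "analytic_flow K \<delta> a c"
proof -
  obtain P \<epsilon>1 where P: "\<epsilon>1 > 0" "P analytic_on {0}" "P 0 = 0"
    and P': "\<And>x. x \<in> {0<..<\<epsilon>1} \<Longrightarrow> \<exists>\<rho>. \<rho> a = x \<and> P (complex_of_real x) = of_real (\<rho> b) \<and>
        (\<forall>t\<in>{a..b}. 0 < \<rho> t \<and> \<rho> t < \<delta> \<and> (\<rho> has_real_derivative K t (\<rho> t)) (at t within {a..b}))"
    using 1 unfolding analytic_flow_def by blast
  obtain Q \<epsilon>2 where Q: "\<epsilon>2 > 0" "Q analytic_on {0}" "Q 0 = 0"
    and Q': "\<And>x. x \<in> {0<..<\<epsilon>2} \<Longrightarrow> \<exists>\<rho>. \<rho> b = x \<and> Q (complex_of_real x) = of_real (\<rho> c) \<and>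
        (\<forall>t\<in>{b..c}. 0 < \<rho> t \<and> \<rho> t < \<delta> \<and> (\<rho> has_real_derivative K t (\<rho> t)) (at t within {b..c}))"
    using 2 unfolding analytic_flow_def by blast
  have "isCont P 0" using P(2) by (simp add: analytic_at_imp_isCont)
  then obtain e where e: "e > 0" "\<And>z. norm z < e \<Longrightarrow> norm (P z) < \<epsilon>2"
    using Q(1) P(3) unfolding continuous_at_eps_delta by (metis dist_0_norm dist_commute)
  have "\<exists>\<rho>. \<rho> a = x \<and> (Q \<circ> P) (complex_of_real x) = of_real (\<rho> c) \<and>
        (\<forall>t\<in>{a..c}. 0 < \<rho> t \<and> \<rho> t < \<delta> \<and> (\<rho> has_real_derivative K t (\<rho> t)) (at t within {a..c}))"
    if x: "x \<in> {0<..<min \<epsilon>1 e}" for x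
  proof -
    obtain \<rho>1 where \<rho>1: "\<rho>1 a = x" "P (complex_of_real x) = of_real (\<rho>1 b)"
        "\<And>t. t \<in> {a..b} \<Longrightarrow> 0 < \<rho>1 t \<and> \<rho>1 t < \<delta> \<and> (\<rho>1 has_real_derivative K t (\<rho>1 t)) (at t within {a..b})"
      using P'[of x] x by auto
    have "\<rho>1 b \<in> {0<..<\<epsilon>2}"
      using \<rho>1(3)[of b] \<open>a \<le> b\<close> e(2)[of "complex_of_real x"] x \<rho>1(2) by auto
    then obtain \<rho>2 where \<rho>2: "\<rho>2 b = \<rho>1 b" "Q (complex_of_real (\<rho>1 b)) = of_real (\<rho>2 c)"
        "\<And>t. t \<in> {b..c} \<Longrightarrow> 0 < \<rho>2 t \<and> \<rho>2 t < \<delta> \<and> (\<rho>2 has_real_derivative K t (\<rho>2 t)) (at t within {b..c})"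
      using Q' by meson
    define \<rho> where "\<rho> = (\<lambda>t. if t \<le> b then \<rho>1 t else \<rho>2 t)"
    have "(\<rho> has_real_derivative K t (\<rho> t)) (at t within {a..c})" if "t \<in> {a..c}" for t
      unfolding \<rho>_def
    proof (rule has_real_derivative_concat[of \<rho>1 b \<rho>2, OF _ that \<open>a \<le> b\<close> \<open>b \<le> c\<close>])
      show "\<rho>1 b = \<rho>2 b" using \<rho>2(1) by simp
      show "t \<le> b \<Longrightarrow> (\<rho>1 has_real_derivative K t (if t \<le> b then \<rho>1 t else \<rho>2 t)) (at t within {a..b})"
        using \<rho>1(3)[of t] that by auto
      show "b \<le> t \<Longrightarrow> (\<rho>2 has_real_derivative K t (if t \<le> b then \<rho>1 t else \<rho>2 t)) (at t within {b..c})"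
        using \<rho>2(1) \<rho>2(3)[of t] that by (cases "t = b") auto
    qed
    moreover have "0 < \<rho> t \<and> \<rho> t < \<delta>" if "t \<in> {a..c}" for t
      using \<rho>1(3)[of t] \<rho>2(3)[of t] that by (auto simp: \<rho>_def)
    ultimately show ?thesis
      using \<rho>1(1,2) \<rho>2(1,2) \<open>a \<le> b\<close> \<open>b \<le> c\<close> by (intro exI[of _ \<rho>]) (auto simp: \<rho>_def)
  qed
  moreover have "(Q \<circ> P) analytic_on {0}"
    by (rule analytic_on_compose) (use P Q in auto)
  ultimately show ?thesis
    unfolding analytic_flow_def using P Q e(1)
    by (intro exI[of _ "Q \<circ> P"] exI[of _ "min \<epsilon>1 e"]) auto
qed

text \<open>Quantifying over all short intervals around t0 is the form of local statement that
  bisection of a compact interval accepts.\<close>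

lemma analytic_flow_local:
  assumes K: "complexifiable K t0" and "\<delta> > 0"
  shows "\<exists>d>0. \<forall>a b. a \<le> t0 \<and> t0 \<le> b \<and> b - a < d \<longrightarrow> analytic_flow K \<delta> a b"
proof -
  obtain d R R' L where d: "d > 0"
    and cR: "continuous_on ({t0 - d..t0 + d} \<times> ball 0 d) (\<lambda>(t, z). R t z)"
    and cR': "continuous_on ({t0 - d..t0 + d} \<times> ball 0 d) (\<lambda>(t, z). R' t z)"
    and all: "\<forall>t\<in>{t0 - d..t0 + d}. R t 0 = 0 \<and>
        (\<forall>z\<in>ball 0 d. (R t has_field_derivative R' t z) (at z) \<and> norm (R' t z) \<le> L) \<and>
        (\<forall>x. \<bar>x\<bar> < d \<longrightarrow> R t (complex_of_real x) = of_real (K t x))"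
    using K unfolding complexifiable_def by blast
  have R: "\<And>t. t \<in> {t0 - d..t0 + d} \<Longrightarrow> R t 0 = 0"
      "\<And>t z. t \<in> {t0 - d..t0 + d} \<Longrightarrow> z \<in> ball 0 d \<Longrightarrow> (R t has_field_derivative R' t z) (at z)"
      "\<And>t z. t \<in> {t0 - d..t0 + d} \<Longrightarrow> z \<in> ball 0 d \<Longrightarrow> norm (R' t z) \<le> L"
      "\<And>t x. t \<in> {t0 - d..t0 + d} \<Longrightarrow> \<bar>x\<bar> < d \<Longrightarrow> R t (complex_of_real x) = of_real (K t x)"
    using all by blast+
  have L: "0 \<le> L" using order_trans[OF norm_ge_zero R(3)[of t0 0]] d by auto
  \<comment> \<open>Chosen so that an interval shorter than d' satisfies (b - a) * L \<le> 1 /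
    4.\<close>
  define d' where "d' = min d (1 / (4 * (L + 1)))"
  have d': "d' > 0" "d' \<le> d" "d' * L \<le> 1 / 4"
  proof -
    have "d' * L \<le> 1 / (4 * (L + 1)) * (L + 1)"
      by (intro mult_mono) (use L d in \<open>auto simp: d'_def\<close>)
    also have "\<dots> = 1 / 4" using L by (simp add: field_simps)
    finally show "d' * L \<le> 1 / 4" .
  qed (use L d in \<open>auto simp: d'_def\<close>)
  have "analytic_flow K \<delta> a b" if ab: "a \<le> t0" "t0 \<le> b" "b - a < d'" for a b
  proof -
    have sub: "{a..b} \<subseteq> {t0 - d..t0 + d}" using ab d' by auto
    interpret holomorphic_ode R R' a b d L
    proof
      show "continuous_on ({a..b} \<times> ball 0 d) (\<lambda>(t, z). R t z)"
        by (rule continuous_on_subset[OF cR]) (use sub in auto)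
      show "continuous_on ({a..b} \<times> ball 0 d) (\<lambda>(t, z). R' t z)"
        by (rule continuous_on_subset[OF cR']) (use sub in auto)
      show "(b - a) * L \<le> 1 / 4"
        using mult_right_mono[of "b - a" d' L] ab d' L by auto
    qed (use ab d R sub in auto)
    \<comment> \<open>x < d / 2 puts the initial value into the ball B, and x < \<delta> / 2 gives
      \<rho> \<le> 3 * x / 2 < \<delta>.\<close>
    define \<epsilon> where "\<epsilon> = min (d / 2) (\<delta> / 2)"
    have "U b analytic_on {0}"
      using U_holomorphic[of b] ab d by (auto simp: analytic_at_ball intro!: exI[of _ "d / 2"])
    moreover have "\<exists>\<rho>. \<rho> a = x \<and> U b (complex_of_real x) = of_real (\<rho> b) \<and>
        (\<forall>t\<in>{a..b}. 0 < \<rho> t \<and> \<rho> t < \<delta> \<and> (\<rho> has_real_derivative K t (\<rho> t)) (at t within {a..b}))"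
      if x: "x \<in> {0<..<\<epsilon>}" for x
    proof (intro exI[of _ "\<lambda>t. Re (U t (of_real x))"] conjI ballI)
      have xB: "complex_of_real x \<in> B" and xd: "\<bar>x\<bar> < d / 2" and x\<delta>: "2 * x < \<delta>" "0 < x"
        using x by (auto simp: \<epsilon>_def)
      have real: "U t (of_real x) = of_real (Re (U t (of_real x)))" if "t \<in> {a..b}" for t
        using U_real[OF _ that xd] R(4) sub by (auto simp: complex_is_Real_iff complex_eq_iff)
      have near: "\<bar>Re (U t (of_real x)) - x\<bar> \<le> x / 2" if "t \<in> {a..b}" for t
      proof -
        have "\<bar>Re (U t (of_real x) - of_real x)\<bar> \<le> norm (U t (of_real x) - of_real x)"
          by (rule abs_Re_le_cmod)
        then show ?thesis using U_near[OF that xB] x\<delta> by simp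
      qed
      show "Re (U a (of_real x)) = x" using U_initial[OF xB] by simp
      show "U b (complex_of_real x) = of_real (Re (U b (of_real x)))" using real[of b] ab by auto
      fix t assume t: "t \<in> {a..b}"
      show pos: "0 < Re (U t (of_real x))" "Re (U t (of_real x)) < \<delta>"
        using near[OF t] x\<delta> unfolding abs_le_iff by linarith+
      have "\<bar>Re (U t (of_real x))\<bar> < d" using near[OF t] xd x\<delta> by linarith
      then have "R t (U t (of_real x)) = of_real (K t (Re (U t (of_real x))))"
        using R(4)[of t "Re (U t (of_real x))"] t sub real[OF t] by auto
      then have "((\<lambda>t. U t (of_real x)) has_vector_derivative of_real (K t (Re (U t (of_real x)))))
          (at t within {a..b})"
        using U_solution[OF t xB] by simp
      from bounded_linear.has_vector_derivative[OF bounded_linear_Re this]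
      show "((\<lambda>t. Re (U t (of_real x))) has_real_derivative K t (Re (U t (of_real x)))) (at t within {a..b})"
        by (simp add: has_real_derivative_iff_has_vector_derivative)
    qed
    ultimately show ?thesis
      unfolding analytic_flow_def using U_0[of b] ab d \<open>\<delta> > 0\<close>
      by (intro exI[of _ "U b"] exI[of _ \<epsilon>]) (auto simp: \<epsilon>_def)
  qed
  then show ?thesis using d'(1) by blast
qed

text \<open>Compactness of [0, T] enters as bisection: flows exist on short intervals around each t
  and compose across adjacent intervals.\<close>

lemma analytic_flow_quotient:
  assumes "real_analytic_on F (UNIV \<times> {0})" "real_analytic_on G (UNIV \<times> {0})"
    and "\<And>\<theta>. F (\<theta>, 0) = 0" and "\<And>t. t \<in> {0..T} \<Longrightarrow> G (\<theta>0 + \<sigma> * t, 0) \<noteq> 0"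
    and "\<bar>\<sigma>\<bar> = 1" and "\<delta> > 0" and "0 \<le> T"
  shows "analytic_flow (\<lambda>t x. \<sigma> * (F (\<theta>0 + \<sigma> * t, x) / G (\<theta>0 + \<sigma> * t, x))) \<delta> 0 T"
  using \<open>0 \<le> T\<close>
proof (induct rule: Bolzano)
  case (trans a b c)
  then show ?case by (rule analytic_flow_trans)
next
  case (local t)
  then show ?case
    by (intro analytic_flow_local complexifiable_quotient assms) auto
qed

section \<open>Orbits between points of the switching curve\<close>

text \<open>A half-return without coordinates or branches, so that time reversal and uniqueness can
  be argued for orbits alone.\<close>

definition travels :: "(plane \<Rightarrow> plane) \<Rightarrow> plane \<Rightarrow> plane \<Rightarrow> plane set \<Rightarrow> bool" where
  "travels Y p q S \<longleftrightarrow>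
     (\<exists>\<tau> > 0. \<exists>\<gamma>. solution Y \<gamma> {0..\<tau>} \<and> \<gamma> 0 = p \<and> \<gamma> \<tau> = q \<and> (\<forall>t\<in>{0<..<\<tau>}. \<gamma> t \<in> S))"

lemma half_returns_iff_travels:
  "half_returns Y S V \<psi> x x' \<longleftrightarrow>
     (x, 0) \<in> V \<and> (x', 0) \<in> V \<and> x * x' < 0 \<and> travels Y (\<psi> (x, 0)) (\<psi> (x', 0)) S"
  unfolding half_returns_def travels_def by blast

lemma travels_mono: "travels Y p q S \<Longrightarrow> S \<subseteq> T \<Longrightarrow> travels Y p q T"
  unfolding travels_def by blast

lemma travels_minus:
  assumes "travels Y p q S"
  shows "travels (\<lambda>p. - Y p) q p S"
proof -
  obtain \<tau> \<gamma> where \<tau>: "\<tau> > 0" and \<gamma>: "solution Y \<gamma> {0..\<tau>}" "\<gamma> 0 = p" "\<gamma> \<tau> = q" "\<forall>t\<in>{0<..<\<tau>}. \<gamma> t \<in> S"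
    using assms unfolding travels_def by blast
  have im: "(\<lambda>t. \<tau> - t) ` {0..\<tau>} = {0..\<tau>}"
    by (auto simp: image_iff intro: bexI[of _ "\<tau> - x" for x])
  have "solution (\<lambda>p. - Y p) (\<gamma> \<circ> (\<lambda>t. \<tau> - t)) {0..\<tau>}"
    unfolding solution_def
  proof
    fix t assume t: "t \<in> {0..\<tau>}"
    have "((\<gamma> \<circ> (\<lambda>t. \<tau> - t)) has_vector_derivative - 1 *\<^sub>R Y (\<gamma> (\<tau> - t))) (at t within {0..\<tau>})"
    proof (rule vector_diff_chain_within)
      show "((\<lambda>t. \<tau> - t) has_vector_derivative - 1) (at t within {0..\<tau>})"
        by (auto intro!: derivative_eq_intros)
      show "(\<gamma> has_vector_derivative Y (\<gamma> (\<tau> - t))) (at (\<tau> - t) within (\<lambda>t. \<tau> - t) ` {0..\<tau>})"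
        unfolding im using \<gamma>(1) t by (auto simp: solution_def)
    qed
    then show "((\<gamma> \<circ> (\<lambda>t. \<tau> - t)) has_vector_derivative - Y ((\<gamma> \<circ> (\<lambda>t. \<tau> - t)) t)) (at t within {0..\<tau>})"
      by simp
  qed
  then show ?thesis
    unfolding travels_def using \<tau> \<gamma>(2-) by (intro exI[of _ \<tau>] conjI exI[of _ "\<gamma> \<circ> (\<lambda>t. \<tau> - t)"]) auto
qed

text \<open>Both end points are first exits from S: the solutions agree while both run, and if one
  stopped earlier, its end point would be an interior point of the other and so belong to S.\<close>

lemma travels_unique:
  assumes lip: "locally_lipschitz Y" and "travels Y p q S" "travels Y p q' S" "q \<notin> S" "q' \<notin> S"
  shows "q = q'"
proof -
  have *: "q1 = q2"
    if le: "\<tau>1 \<le> \<tau>2" and \<tau>: "0 < \<tau>1" and "q1 \<notin> S"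
      and \<gamma>1: "solution Y \<gamma>1 {0..\<tau>1}" "\<gamma>1 0 = p" "\<gamma>1 \<tau>1 = q1"
      and \<gamma>2: "solution Y \<gamma>2 {0..\<tau>2}" "\<gamma>2 0 = p" "\<gamma>2 \<tau>2 = q2" "\<forall>t\<in>{0<..<\<tau>2}. \<gamma>2 t \<in> S"
    for \<tau>1 \<tau>2 \<gamma>1 \<gamma>2 q1 q2
  proof -
    have "\<gamma>1 \<tau>1 = \<gamma>2 \<tau>1"
      by (rule solution_unique[OF lip _ \<gamma>1(1) solution_subset[OF \<gamma>2(1)]]) (use le \<tau> \<gamma>1 \<gamma>2 in auto)
    moreover from this have "\<tau>1 = \<tau>2"
      using \<gamma>1(3) \<gamma>2(4) le \<tau> \<open>q1 \<notin> S\<close> by (metis greaterThanLessThan_iff order_le_less)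
    ultimately show ?thesis using \<gamma>1(3) \<gamma>2(3) by simp
  qed
  obtain \<tau>1 \<gamma>1 where 1: "\<tau>1 > 0" "solution Y \<gamma>1 {0..\<tau>1}" "\<gamma>1 0 = p" "\<gamma>1 \<tau>1 = q" "\<forall>t\<in>{0<..<\<tau>1}. \<gamma>1 t \<in> S"
    using assms(2) unfolding travels_def by blast
  obtain \<tau>2 \<gamma>2 where 2: "\<tau>2 > 0" "solution Y \<gamma>2 {0..\<tau>2}" "\<gamma>2 0 = p" "\<gamma>2 \<tau>2 = q'" "\<forall>t\<in>{0<..<\<tau>2}. \<gamma>2 t \<in> S"
    using assms(3) unfolding travels_def by blast
  show ?thesis
  proof (cases "\<tau>1 \<le> \<tau>2")
    case True
    then show ?thesis using *[OF True 1(1) assms(4) 1(2-4) 2(2-5)] by simp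
  next
    case False
    then have "\<tau>2 \<le> \<tau>1" by simp
    from *[OF this 2(1) assms(5) 2(2-4) 1(2-5)] show ?thesis by simp
  qed
qed

text \<open>By the intermediate value theorem s takes every value in [s a, s b], so \<gamma> shifted
  by s a solves on [0, s b - s a]; a time strictly inside is attained at an angle other than a and
  b.\<close>

lemma travels_of_time_change:
  fixes s :: "real \<Rightarrow> real"
  assumes "continuous_on {a..b} s" and "a \<le> b" and "solution Y \<gamma> (s ` {a..b})"
    and c: "\<And>\<theta>. \<theta> \<in> {a..b} \<Longrightarrow> c \<theta> = \<gamma> (s \<theta>)" and lt: "s a < s b"
  shows "travels Y (c a) (c b) (c ` {a<..<b})"
proof -
  define \<tau> where "\<tau> = s b - s a"
  have ivt: "\<exists>\<theta>\<in>{a..b}. s \<theta> = s a + t" if "t \<in> {0..\<tau>}" for t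
    using IVT'[of s a "s a + t" b] assms that by (auto simp: \<tau>_def)
  have im: "(\<lambda>t. s a + t) ` {0..\<tau>} \<subseteq> s ` {a..b}"
    using ivt by force
  have "solution Y (\<gamma> \<circ> (\<lambda>t. s a + t)) {0..\<tau>}"
    unfolding solution_def
  proof
    fix t assume t: "t \<in> {0..\<tau>}"
    have "((\<gamma> \<circ> (\<lambda>t. s a + t)) has_vector_derivative 1 *\<^sub>R Y (\<gamma> (s a + t))) (at t within {0..\<tau>})"
    proof (rule vector_diff_chain_within)
      show "((\<lambda>t. s a + t) has_vector_derivative 1) (at t within {0..\<tau>})"
        by (auto intro!: derivative_eq_intros)
      show "(\<gamma> has_vector_derivative Y (\<gamma> (s a + t))) (at (s a + t) within (\<lambda>t. s a + t) ` {0..\<tau>})"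
        using solution_subset[OF assms(3) im] t by (auto simp: solution_def)
    qed
    then show "((\<gamma> \<circ> (\<lambda>t. s a + t)) has_vector_derivative Y ((\<gamma> \<circ> (\<lambda>t. s a + t)) t)) (at t within {0..\<tau>})"
      by simp
  qed
  moreover have "(\<gamma> \<circ> (\<lambda>t. s a + t)) t \<in> c ` {a<..<b}" if t: "t \<in> {0<..<\<tau>}" for t
  proof -
    obtain \<theta> where \<theta>: "\<theta> \<in> {a..b}" "s \<theta> = s a + t" using ivt[of t] t by auto
    moreover have "\<theta> \<noteq> a" "\<theta> \<noteq> b" using \<theta> t by (auto simp: \<tau>_def)
    ultimately show ?thesis using c[OF \<theta>(1)] by (intro image_eqI[of _ _ \<theta>]) auto
  qed
  ultimately show ?thesis
    unfolding travels_def using lt c \<open>a \<le> b\<close>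
    by (intro exI[of _ \<tau>] conjI exI[of _ "\<gamma> \<circ> (\<lambda>t. s a + t)"]) (auto simp: \<tau>_def)
qed

text \<open>The time change of an orbit arc may reverse the orientation, hence the disjunction. A
  decreasing one becomes increasing under the reflection \<theta> to a + b - \<theta>, which
  exchanges the end points.\<close>

lemma orbit_arc_travels:
  assumes "orbit_arc Y c a b" "a < b"
  shows "travels Y (c a) (c b) (c ` {a<..<b}) \<or> travels Y (c b) (c a) (c ` {a<..<b})"
proof -
  obtain s \<gamma> where s: "continuous_on {a..b} s" "inj_on s {a..b}" "solution Y \<gamma> (s ` {a..b})"
    and c: "\<And>\<theta>. \<theta> \<in> {a..b} \<Longrightarrow> c \<theta> = \<gamma> (s \<theta>)"
    using assms(1) unfolding orbit_arc_def by blast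
  have "s a \<noteq> s b" using s(2) assms(2) by (auto simp: inj_on_eq_iff)
  then consider "s a < s b" | "s b < s a" by linarith
  then show ?thesis
  proof cases
    case 1
    then show ?thesis using travels_of_time_change[OF s(1) _ s(3) c 1] assms(2) by simp
  next
    case 2
    let ?r = "\<lambda>\<theta>. a + b - \<theta>"
    have rev: "?r ` A = A" if "\<And>x. x \<in> A \<Longrightarrow> ?r x \<in> A" for A
    proof safe
      fix x assume "x \<in> A"
      then have "?r (?r x) \<in> ?r ` A" using that by blast
      then show "x \<in> ?r ` A" by simp
    qed (use that in auto)
    have im: "?r ` {a..b} = {a..b}" "?r ` {a<..<b} = {a<..<b}"
      by (rule rev; simp)+
    have "travels Y ((c \<circ> ?r) a) ((c \<circ> ?r) b) ((c \<circ> ?r) ` {a<..<b})"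
    proof (rule travels_of_time_change)
      show "continuous_on {a..b} (s \<circ> ?r)"
        by (rule continuous_on_compose) (use s(1) im in \<open>auto intro!: continuous_intros\<close>)
      show "solution Y \<gamma> ((s \<circ> ?r) ` {a..b})"
        using s(3) by (simp only: image_comp[symmetric] im)
    qed (use 2 assms(2) c in auto)
    then show ?thesis by (simp only: image_comp[symmetric] im) simp
  qed
qed

section \<open>Crossing direction at the switching curve\<close>

lemma lie_derivative_minus: "lie_derivative (\<lambda>p. - Y p) f p = - lie_derivative Y f p"
  by (simp add: lie_derivative_def)

text \<open>\<nu> * f vanishes at the start and is positive right afterwards, so its one-sided
  derivative there is nonnegative. The sign \<nu> covers both sides of the curve.\<close>

lemma travels_lie_derivative_start:
  assumes f: "real_analytic_on f UNIV" and tr: "travels Y p q S" and "f p = 0"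
    and S: "\<And>x. x \<in> S \<Longrightarrow> \<nu> * f x > 0"
  shows "\<nu> * lie_derivative Y f p \<ge> 0"
proof -
  obtain \<tau> \<gamma> where \<tau>: "\<tau> > 0" and \<gamma>: "solution Y \<gamma> {0..\<tau>}" "\<gamma> 0 = p" "\<forall>t\<in>{0<..<\<tau>}. \<gamma> t \<in> S"
    using tr unfolding travels_def by blast
  have "(\<gamma> has_derivative (\<lambda>h. h *\<^sub>R Y p)) (at 0 within {0..\<tau>})"
    using \<gamma> \<tau> by (auto simp: solution_def has_vector_derivative_def)
  from has_derivative_compose[OF this, of f "\<lambda>h. h \<bullet> gradient f p"]
  have "((\<lambda>t. f (\<gamma> t)) has_derivative (\<lambda>h. h *\<^sub>R Y p \<bullet> gradient f p)) (at 0 within {0..\<tau>})"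
    using real_analytic_has_derivative[OF f, of p] \<gamma>(2) by simp
  then have "((\<lambda>t. f (\<gamma> t)) has_real_derivative lie_derivative Y f p) (at 0 within {0..\<tau>})"
    by (simp add: has_field_derivative_def lie_derivative_def inner_commute mult.commute[of _ "inner _ _"])
  then have "((\<lambda>t. \<nu> * f (\<gamma> t)) has_real_derivative \<nu> * lie_derivative Y f p) (at 0 within {0..\<tau>})"
    by (rule DERIV_cmult)
  then have lim: "((\<lambda>t. \<nu> * f (\<gamma> t) / t) \<longlongrightarrow> \<nu> * lie_derivative Y f p) (at 0 within {0..\<tau>})"
    using \<gamma>(2) \<open>f p = 0\<close> by (simp add: has_field_derivative_iff)
  show ?thesis
  proof (rule tendsto_lowerbound[OF lim])
    show "\<forall>\<^sub>F t in at 0 within {0..\<tau>}. 0 \<le> \<nu> * f (\<gamma> t) / t"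
      unfolding eventually_at
    proof (intro exI[of _ \<tau>] conjI ballI impI \<tau>)
      fix t assume "t \<in> {0..\<tau>}" "t \<noteq> 0 \<and> dist t 0 < \<tau>"
      then have "t \<in> {0<..<\<tau>}" by (auto simp: dist_real_def)
      then show "0 \<le> \<nu> * f (\<gamma> t) / t"
        using S[of "\<gamma> t"] \<gamma>(3) by (auto intro!: divide_nonneg_pos less_imp_le)
    qed
    show "at 0 within {0..\<tau>} \<noteq> bot"
      using \<tau> by (simp add: at_within_eq_bot_iff)
        (metis at_within_Icc_at_right at_within_eq_bot_iff trivial_limit_at_right_real)
  qed
qed

lemma travels_lie_derivative_end:
  assumes "real_analytic_on f UNIV" "travels Y p q S" "f q = 0" "\<And>x. x \<in> S \<Longrightarrow> \<nu> * f x > 0"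
  shows "\<nu> * lie_derivative Y f q \<le> 0"
  using travels_lie_derivative_start[OF assms(1) travels_minus[OF assms(2)] assms(3,4)]
  by (simp add: lie_derivative_minus)

section \<open>The switching curve in straightened coordinates near the singular point\<close>

lemma straightening_psi:
  assumes "straightening f p0 U V \<phi> \<psi>"
  shows "continuous_on V \<psi>" "\<And>v. v \<in> V \<Longrightarrow> \<phi> (\<psi> v) = v" "inj_on \<psi> V" "open V" "(0, 0) \<in> V" "\<psi> (0, 0) = p0"
proof -
  have h: "homeomorphism U V \<phi> \<psi>" "open V" "p0 \<in> U" "\<phi> p0 = (0, 0)"
    using assms unfolding straightening_def by auto
  show "continuous_on V \<psi>" "\<And>v. v \<in> V \<Longrightarrow> \<phi> (\<psi> v) = v" "open V"
    using h by (auto simp: homeomorphism_def)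
  then show "inj_on \<psi> V" by (metis inj_on_inverseI)
  show "(0, 0) \<in> V" "\<psi> (0, 0) = p0"
    using h by (auto simp: homeomorphism_def) (metis imageI)+
qed

lemma straightening_sign:
  assumes st: "straightening f p0 U V \<phi> \<psi>" and v: "v \<in> V"
  shows "snd v = 0 \<Longrightarrow> f (\<psi> v) = 0" "snd v > 0 \<Longrightarrow> f (\<psi> v) > 0" "snd v < 0 \<Longrightarrow> f (\<psi> v) < 0"
proof -
  have inv: "\<And>u. u \<in> U \<Longrightarrow> \<psi> (\<phi> u) = u"
    using st unfolding straightening_def homeomorphism_def by auto
  have *: "\<psi> v \<in> A" if "\<phi> ` (U \<inter> A) = V \<inter> B" "v \<in> B" for A B
  proof -
    from that v obtain u where "u \<in> U" "u \<in> A" "v = \<phi> u" by blast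
    then show ?thesis using inv by simp
  qed
  have im: "\<phi> ` (U \<inter> Sw f) = V \<inter> {z. snd z = 0}" "\<phi> ` (U \<inter> Sw_pos f) = V \<inter> {z. snd z > 0}"
    "\<phi> ` (U \<inter> Sw_neg f) = V \<inter> {z. snd z < 0}"
    using st unfolding straightening_def by auto
  show "snd v = 0 \<Longrightarrow> f (\<psi> v) = 0" using *[OF im(1)] by (simp add: Sw_def)
  show "snd v > 0 \<Longrightarrow> f (\<psi> v) > 0" using *[OF im(2)] by (simp add: Sw_pos_def)
  show "snd v < 0 \<Longrightarrow> f (\<psi> v) < 0" using *[OF im(3)] by (simp add: Sw_neg_def)
qed

text \<open>Isolation makes every other nearby point of the curve regular, hence sewing, sliding or
  escaping. In the last two cases the product of the Lie derivatives is negative, which the third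
  kind of characteristic orbit rules out close to p0.\<close>

lemma monodromic_sewing_near:
  assumes mon: "monodromic f Xp Xm p0" and st: "straightening f p0 U V \<phi> \<psi>"
  obtains \<kappa> where "\<kappa> > 0"
    "\<And>x. \<bar>x\<bar> < \<kappa> \<Longrightarrow> (x, 0) \<in> V"
    "\<And>x. \<bar>x\<bar> < \<kappa> \<Longrightarrow> x \<noteq> 0 \<Longrightarrow>
       lie_derivative Xp f (\<psi> (x, 0)) * lie_derivative Xm f (\<psi> (x, 0)) > 0"
proof -
  note psi = straightening_psi[OF st]
  obtain N where N: "open N" "p0 \<in> N" "\<And>q. q \<in> N \<Longrightarrow> Sw_singular f Xp Xm q \<Longrightarrow> q = p0"
    using mon unfolding monodromic_def isolated_Sw_singular_def by blast
  obtain N' where N': "open N'" "p0 \<in> N'"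
    "\<And>q. q \<in> N' \<inter> Sw f \<Longrightarrow> \<not> lie_derivative Xp f q * lie_derivative Xm f q < 0"
    using mon unfolding monodromic_def has_characteristic_orbit_def by blast
  have "open (V \<inter> \<psi> -` (N \<inter> N'))"
    using N(1) N'(1) by (intro continuous_open_preimage psi) auto
  moreover have "(0, 0) \<in> V \<inter> \<psi> -` (N \<inter> N')" using psi N N' by auto
  ultimately obtain \<kappa> where \<kappa>: "\<kappa> > 0" "ball (0, 0) \<kappa> \<subseteq> V \<inter> \<psi> -` (N \<inter> N')"
    by (meson open_contains_ball)
  have in_ball: "(x, 0) \<in> ball (0, 0) \<kappa>" if "\<bar>x\<bar> < \<kappa>" for x :: real
    using that by (simp add: dist_Pair_Pair dist_real_def)
  show thesis
  proof
    show "\<kappa> > 0" by fact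
    show V: "(x, 0) \<in> V" if "\<bar>x\<bar> < \<kappa>" for x using in_ball[OF that] \<kappa>(2) by blast
    fix x assume x: "\<bar>x\<bar> < \<kappa>" "x \<noteq> 0"
    let ?q = "\<psi> (x, 0)"
    have q: "?q \<in> N" "?q \<in> N'" using in_ball[OF x(1)] \<kappa>(2) by auto
    have "?q \<noteq> p0" using psi(2)[OF V[OF x(1)]] psi(2)[OF psi(5)] psi(6) x(2) by auto
    moreover have sw: "?q \<in> Sw f" using straightening_sign(1)[OF st V[OF x(1)]] by (simp add: Sw_def)
    ultimately have "Sw_regular f Xp Xm ?q"
      using N(3)[OF q(1)] unfolding Sw_singular_def by blast
    then show "lie_derivative Xp f ?q * lie_derivative Xm f ?q > 0"
      using N'(3)[of ?q] q(2) sw unfolding Sw_regular_def sewing_def sliding_def escaping_def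
      by (auto simp: mult_less_0_iff)
  qed
qed

lemma continuous_nonzero_constant_sign:
  fixes g :: "real \<Rightarrow> real"
  assumes "continuous_on S g" "connected S" "\<And>x. x \<in> S \<Longrightarrow> g x \<noteq> 0" "a \<in> S" "g a > 0" "x \<in> S"
  shows "g x > 0"
proof (rule ccontr)
  assume "\<not> g x > 0"
  moreover have "connected (g ` S)" by (rule connected_continuous_image[OF assms(1,2)])
  ultimately have "0 \<in> g ` S"
    using assms(4-6) connected_contains_Icc[of "g ` S" "g x" "g a"] by force
  then show False using assms(3) by auto
qed

lemma continuous_on_lie_derivative:
  assumes "real_analytic_on f UNIV" "analytic_vector_field Y"
  shows "continuous_on UNIV (lie_derivative Y f)"
proof -
  have c: "continuous_on UNIV g" if "real_analytic_on g UNIV" for g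
    by (rule continuous_at_imp_continuous_on)
       (use has_derivative_continuous[OF real_analytic_has_derivative[OF that]] in auto)
  have "continuous_on UNIV (\<lambda>p. (fst (Y p), snd (Y p)))"
    using assms(2) unfolding analytic_vector_field_def by (intro continuous_on_Pair c) auto
  then show ?thesis
    unfolding lie_derivative_def by (intro continuous_intros continuous_on_gradient assms) simp
qed

section \<open>Half-return maps\<close>

text \<open>An arc in the sector on the side \<open>\<nu>\<close> of the switching curve is parametrised by \<open>t \<in> [0, \<pi>]\<close>
  starting from the branch of sign \<open>\<sigma>\<close>; its angle is then \<open>\<theta> = angle0 \<sigma> \<nu> + \<sigma> * \<nu> * t\<close>.\<close>

definition angle0 :: "real \<Rightarrow> real \<Rightarrow> real" where
  "angle0 \<sigma> \<nu> = (if \<sigma> = 1 then 0 else \<nu> * pi)"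

text \<open>The factor \<open>\<sigma> * \<nu>\<close> is the derivative of the angle with respect
  to t.\<close>

definition polar_rhs :: "(plane \<Rightarrow> real) \<Rightarrow> (plane \<Rightarrow> real) \<Rightarrow> real \<Rightarrow> real \<Rightarrow> real \<Rightarrow> real \<Rightarrow> real" where
  "polar_rhs F G \<sigma> \<nu> t x =
     \<sigma> * \<nu> * (F (angle0 \<sigma> \<nu> + \<sigma> * \<nu> * t, x) / G (angle0 \<sigma> \<nu> + \<sigma> * \<nu> * t, x))"

text \<open>At the two ends the sine vanishes and the cosine is \<sigma> and -\<sigma>, so only the
  exponent of the first coordinate remains. The direction of travel is left open here and fixed
  later by the sign of a Lie derivative.\<close>

definition sector_arcs ::
  "(plane \<Rightarrow> real) \<Rightarrow> (plane \<Rightarrow> plane) \<Rightarrow> plane set \<Rightarrow> (plane \<Rightarrow> plane) \<Rightarrow> (real \<Rightarrow> real \<Rightarrow> real) \<Rightarrow>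
   nat \<Rightarrow> real \<Rightarrow> real \<Rightarrow> real \<Rightarrow> bool" where
  "sector_arcs f Y V \<psi> K m \<sigma> \<nu> \<delta> \<longleftrightarrow>
     (\<forall>\<rho>. (\<forall>t\<in>{0..pi}. 0 < \<rho> t \<and> \<rho> t < \<delta> \<and> (\<rho> has_real_derivative K t (\<rho> t)) (at t within {0..pi})) \<longrightarrow>
        (\<sigma> * \<rho> 0 ^ m, 0) \<in> V \<and> (- \<sigma> * \<rho> pi ^ m, 0) \<in> V \<and>
        (travels Y (\<psi> (\<sigma> * \<rho> 0 ^ m, 0)) (\<psi> (- \<sigma> * \<rho> pi ^ m, 0)) {p. \<nu> * f p > 0} \<or>
         travels Y (\<psi> (- \<sigma> * \<rho> pi ^ m, 0)) (\<psi> (\<sigma> * \<rho> 0 ^ m, 0)) {p. \<nu> * f p > 0}))"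

lemma sector_arcs_minus:
  "sector_arcs f Y V \<psi> K m \<sigma> \<nu> \<delta> \<Longrightarrow> sector_arcs f (\<lambda>p. - Y p) V \<psi> K m \<sigma> \<nu> \<delta>"
  unfolding sector_arcs_def using travels_minus[of Y] by blast

lemma angle_range:
  assumes "\<sigma> = 1 \<or> \<sigma> = - 1" "\<nu> = 1 \<or> \<nu> = - 1" "t \<in> {0..pi}"
  shows "angle0 \<sigma> \<nu> + \<sigma> * \<nu> * t \<in> (if \<nu> = 1 then {0..pi} else {-pi..0})"
  using assms by (auto simp: angle0_def)

text \<open>Expressed in the angle instead of t, \<rho> solves the polar equation over the whole
  sector, and the equivalence turns its graph into an orbit arc joining the two branches.\<close>

lemma polar_equivalent_sector_arcs:
  assumes st: "straightening f p0 U V \<phi> \<psi>"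
    and \<sigma>: "\<sigma> = 1 \<or> \<sigma> = - 1" and \<nu>: "\<nu> = 1 \<or> \<nu> = - 1"
    and pe: "polar_equivalent Y V \<psi> m n (if \<nu> = 1 then 0 else - pi) (if \<nu> = 1 then pi else 0) F G"
  shows "\<exists>\<delta>>0. sector_arcs f Y V \<psi> (polar_rhs F G \<sigma> \<nu>) m \<sigma> \<nu> \<delta>"
proof -
  define \<alpha> \<beta> where "\<alpha> = (if \<nu> = 1 then 0 else - pi)" and "\<beta> = (if \<nu> = 1 then pi else 0)"
  have \<alpha>\<beta>: "\<alpha> < \<beta>" by (simp add: \<alpha>_def \<beta>_def)
  obtain \<delta> where \<delta>: "\<delta> > 0" and wp: "\<forall>\<theta>\<in>{\<alpha>..\<beta>}. \<forall>\<rho>\<in>{0<..<\<delta>}. weighted_polar m n \<theta> \<rho> \<in> V"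
    and all: "\<forall>a b \<rho>. \<alpha> \<le> a \<longrightarrow> a < b \<longrightarrow> b \<le> \<beta> \<longrightarrow> continuous_on {a..b} \<rho> \<longrightarrow>
      \<rho> ` {a..b} \<subseteq> {0<..<\<delta>} \<longrightarrow>
      ((\<forall>\<theta>\<in>{a..b}. (\<rho> has_real_derivative F (\<theta>, \<rho> \<theta>) / G (\<theta>, \<rho> \<theta>)) (at \<theta> within {a..b}))
        \<longleftrightarrow> orbit_arc Y (\<lambda>\<theta>. \<psi> (weighted_polar m n \<theta> (\<rho> \<theta>))) a b)"
    using pe unfolding polar_equivalent_def \<alpha>_def[symmetric] \<beta>_def[symmetric] by blast
  note eqv = iffD1[OF all[rule_format, OF order_refl \<alpha>\<beta> order_refl]]
  define s \<theta>0 where "s = \<sigma> * \<nu>" and "\<theta>0 = angle0 \<sigma> \<nu>"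
  have s: "s = 1 \<or> s = - 1" using \<sigma> \<nu> by (auto simp: s_def)
  have ss: "s * s = 1" using s by auto
  have ends: "s = 1 \<Longrightarrow> \<theta>0 = \<alpha> \<and> \<theta>0 + pi = \<beta>" "s = - 1 \<Longrightarrow> \<theta>0 = \<beta> \<and> \<theta>0 - pi = \<alpha>"
    using \<sigma> \<nu> by (auto simp: s_def \<theta>0_def angle0_def \<alpha>_def \<beta>_def)
  have cs: "cos (\<theta>0 + s * t) = \<sigma> * cos t" "sin (\<theta>0 + s * t) = \<nu> * sin t" for t
    using \<sigma> \<nu> by (auto simp: s_def \<theta>0_def angle0_def cos_diff sin_diff cos_add sin_add)
  have "sector_arcs f Y V \<psi> (polar_rhs F G \<sigma> \<nu>) m \<sigma> \<nu> \<delta>"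
    unfolding sector_arcs_def
  proof (intro allI impI)
    fix \<rho> :: "real \<Rightarrow> real"
    assume \<rho>: "\<forall>t\<in>{0..pi}. 0 < \<rho> t \<and> \<rho> t < \<delta> \<and>
      (\<rho> has_real_derivative polar_rhs F G \<sigma> \<nu> t (\<rho> t)) (at t within {0..pi})"
    \<comment> \<open>The inverse of the map t to \<theta>0 + s * t, since s * s = 1.\<close>
    define T where "T \<theta> = s * (\<theta> - \<theta>0)" for \<theta>
    have T: "T ` {\<alpha>..\<beta>} \<subseteq> {0..pi}" "\<And>\<theta>. \<theta> \<in> {\<alpha><..<\<beta>} \<Longrightarrow> T \<theta> \<in> {0<..<pi}"
      using s ends by (auto simp: T_def)
    have T_inv: "\<theta>0 + s * T \<theta> = \<theta>" for \<theta> using s by (auto simp: T_def)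
    define \<rho>' where "\<rho>' = \<rho> \<circ> T"
    have der: "(\<rho>' has_real_derivative F (\<theta>, \<rho>' \<theta>) / G (\<theta>, \<rho>' \<theta>)) (at \<theta> within {\<alpha>..\<beta>})"
      if \<theta>: "\<theta> \<in> {\<alpha>..\<beta>}" for \<theta>
    proof -
      have "(\<rho>' has_real_derivative polar_rhs F G \<sigma> \<nu> (T \<theta>) (\<rho> (T \<theta>)) * s) (at \<theta> within {\<alpha>..\<beta>})"
        unfolding \<rho>'_def
      proof (rule DERIV_image_chain)
        show "(T has_real_derivative s) (at \<theta> within {\<alpha>..\<beta>})"
          unfolding T_def by (auto intro!: derivative_eq_intros)
        show "(\<rho> has_real_derivative polar_rhs F G \<sigma> \<nu> (T \<theta>) (\<rho> (T \<theta>))) (at (T \<theta>) within T ` {\<alpha>..\<beta>})"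
          by (rule DERIV_subset[OF _ T(1)]) (use \<rho> T(1) \<theta> in blast)
      qed
      also have "polar_rhs F G \<sigma> \<nu> (T \<theta>) (\<rho> (T \<theta>)) * s = (s * s) * (F (\<theta>, \<rho>' \<theta>) / G (\<theta>, \<rho>' \<theta>))"
        unfolding polar_rhs_def \<theta>0_def[symmetric] s_def[symmetric] T_inv by (simp add: \<rho>'_def)
      finally show ?thesis using ss by simp
    qed
    have \<rho>'_range: "\<rho>' ` {\<alpha>..\<beta>} \<subseteq> {0<..<\<delta>}" using \<rho> T(1) by (auto simp: \<rho>'_def)
    define c where "c \<theta> = \<psi> (weighted_polar m n \<theta> (\<rho>' \<theta>))" for \<theta>
    have "orbit_arc Y c \<alpha> \<beta>"
      unfolding c_def by (rule eqv[OF _ \<rho>'_range])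
        (use DERIV_continuous[OF der] der in \<open>auto simp: continuous_on_eq_continuous_within\<close>)
    then have tr: "travels Y (c \<alpha>) (c \<beta>) (c ` {\<alpha><..<\<beta>}) \<or> travels Y (c \<beta>) (c \<alpha>) (c ` {\<alpha><..<\<beta>})"
      using orbit_arc_travels \<alpha>\<beta> by blast
    \<comment> \<open>Inside the sector the second coordinate is \<nu> times a power of \<rho> times
      sin t with sin t > 0, so straightening puts the arc on the side \<nu> of the curve.\<close>
    have side: "c ` {\<alpha><..<\<beta>} \<subseteq> {p. \<nu> * f p > 0}"
    proof
      fix p assume "p \<in> c ` {\<alpha><..<\<beta>}"
      then obtain \<theta> where \<theta>: "\<theta> \<in> {\<alpha><..<\<beta>}" and p: "p = c \<theta>" by blast
      then have V: "weighted_polar m n \<theta> (\<rho>' \<theta>) \<in> V"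
        by (intro bspec[OF bspec[OF wp]]) (use \<rho>'_range \<theta> in \<open>auto simp: image_subset_iff\<close>)
      have pos: "\<rho>' \<theta> > 0" "sin (T \<theta>) > 0"
        using \<rho>'_range \<theta> T(2)[OF \<theta>] by (auto simp: image_subset_iff intro: sin_gt_zero)
      have "snd (weighted_polar m n \<theta> (\<rho>' \<theta>)) = \<nu> * (\<rho>' \<theta> ^ n * sin (T \<theta>))"
        using cs(2)[of "T \<theta>"] by (simp add: weighted_polar_def T_inv)
      moreover have "\<rho>' \<theta> ^ n * sin (T \<theta>) > 0" using pos by simp
      ultimately have "\<nu> * f (c \<theta>) > 0"
        using straightening_sign(2,3)[OF st V] \<nu> unfolding c_def by auto
      then show "p \<in> {p. \<nu> * f p > 0}" by (simp add: p)
    qed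
    have wp_start: "weighted_polar m n \<theta>0 (\<rho>' \<theta>0) = (\<sigma> * \<rho> 0 ^ m, 0)"
      using cs[of 0] by (simp add: weighted_polar_def \<rho>'_def T_def)
    have wp_end: "weighted_polar m n (\<theta>0 + s * pi) (\<rho>' (\<theta>0 + s * pi)) = (- \<sigma> * \<rho> pi ^ m, 0)"
      using cs[of pi] ss by (simp add: weighted_polar_def \<rho>'_def T_def mult.assoc[symmetric])
    have ends': "\<theta>0 = \<alpha> \<and> \<theta>0 + s * pi = \<beta> \<or> \<theta>0 = \<beta> \<and> \<theta>0 + s * pi = \<alpha>"
      using s ends by auto
    then have in_sector: "\<theta>0 \<in> {\<alpha>..\<beta>}" "\<theta>0 + s * pi \<in> {\<alpha>..\<beta>}"
      using \<alpha>\<beta> by auto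
    have in_V: "weighted_polar m n \<theta> (\<rho>' \<theta>) \<in> V" if "\<theta> \<in> {\<alpha>..\<beta>}" for \<theta>
      using wp \<rho>'_range that by blast
    have "travels Y (c \<theta>0) (c (\<theta>0 + s * pi)) {p. \<nu> * f p > 0} \<or>
        travels Y (c (\<theta>0 + s * pi)) (c \<theta>0) {p. \<nu> * f p > 0}"
      using ends' tr travels_mono[OF _ side] by (elim disjE conjE) simp_all
    then show "(\<sigma> * \<rho> 0 ^ m, 0) \<in> V \<and> (- \<sigma> * \<rho> pi ^ m, 0) \<in> V \<and>
        (travels Y (\<psi> (\<sigma> * \<rho> 0 ^ m, 0)) (\<psi> (- \<sigma> * \<rho> pi ^ m, 0)) {p. \<nu> * f p > 0} \<or>
         travels Y (\<psi> (- \<sigma> * \<rho> pi ^ m, 0)) (\<psi> (\<sigma> * \<rho> 0 ^ m, 0)) {p. \<nu> * f p > 0})"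
      using in_V[OF in_sector(1)] in_V[OF in_sector(2)] unfolding c_def wp_start wp_end by blast
  qed
  then show ?thesis using \<delta> by blast
qed

lemma polar_flow:
  assumes "real_analytic_on F (UNIV \<times> {0})" "real_analytic_on G (UNIV \<times> {0})"
    and "\<And>\<theta>. F (\<theta>, 0) = 0"
    and "\<And>\<theta>. \<theta> \<in> (if \<nu> = 1 then {0..pi} else {-pi..0}) \<Longrightarrow> G (\<theta>, 0) \<noteq> 0"
    and \<sigma>: "\<sigma> = 1 \<or> \<sigma> = - 1" and \<nu>: "\<nu> = 1 \<or> \<nu> = - 1" and "\<delta> > 0"
  shows "analytic_flow (polar_rhs F G \<sigma> \<nu>) \<delta> 0 pi"
  unfolding polar_rhs_def[abs_def]
  by (rule analytic_flow_quotient) (use assms angle_range[OF \<sigma> \<nu>] in auto)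

text \<open>An arc ending on the branch of sign \<sigma> would force \<nu> times the Lie derivative
  to be \<le> 0 there, against the assumed sign, so the arc starts there. Uniqueness holds among all
  solutions of Y, as the definite description requires, and passes to coordinates by injectivity of
  \<psi>.\<close>

lemma half_return_analytic:
  assumes f: "real_analytic_on f UNIV" and lip: "locally_lipschitz Y"
    and st: "straightening f p0 U V \<phi> \<psi>"
    and \<sigma>: "\<sigma> = 1 \<or> \<sigma> = - 1" and \<nu>: "\<nu> = 1 \<or> \<nu> = - 1" and m: "m > 0"
    and arcs: "sector_arcs f Y V \<psi> K m \<sigma> \<nu> \<delta>" and flow: "analytic_flow K \<delta> 0 pi"
    and \<kappa>: "\<kappa> > 0" and lie: "\<And>x. x \<in> {0<..<\<kappa>} \<Longrightarrow> \<nu> * lie_derivative Y f (\<psi> (\<sigma> * x, 0)) > 0"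
  shows "\<exists>P. \<exists>\<epsilon>>0. P analytic_on {0} \<and> P 0 = 0 \<and>
    (\<forall>x\<in>{0<..<\<epsilon>}. \<exists>y. P (complex_of_real x) = complex_of_real y \<and>
      half_returns Y {p. \<nu> * f p > 0} V \<psi> (\<sigma> * x ^ m) (- \<sigma> * y ^ m) \<and>
      (\<forall>x'. half_returns Y {p. \<nu> * f p > 0} V \<psi> (\<sigma> * x ^ m) x' \<longrightarrow> x' = - \<sigma> * y ^ m))"
proof -
  let ?S = "{p. \<nu> * f p > 0}"
  obtain P \<epsilon> where P: "\<epsilon> > 0" "P analytic_on {0}" "P 0 = 0"
    and P': "\<And>x. x \<in> {0<..<\<epsilon>} \<Longrightarrow> \<exists>\<rho>. \<rho> 0 = x \<and> P (complex_of_real x) = of_real (\<rho> pi) \<and>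
        (\<forall>t\<in>{0..pi}. 0 < \<rho> t \<and> \<rho> t < \<delta> \<and> (\<rho> has_real_derivative K t (\<rho> t)) (at t within {0..pi}))"
    using flow unfolding analytic_flow_def by blast
  have "\<exists>y. P (complex_of_real x) = complex_of_real y \<and>
      half_returns Y ?S V \<psi> (\<sigma> * x ^ m) (- \<sigma> * y ^ m) \<and>
      (\<forall>x'. half_returns Y ?S V \<psi> (\<sigma> * x ^ m) x' \<longrightarrow> x' = - \<sigma> * y ^ m)"
    if x: "x \<in> {0<..<min \<epsilon> (min 1 \<kappa>)}" for x
  proof -
    obtain \<rho> where \<rho>: "\<rho> 0 = x" "P (complex_of_real x) = of_real (\<rho> pi)"
      and \<rho>': "\<forall>t\<in>{0..pi}. 0 < \<rho> t \<and> \<rho> t < \<delta> \<and> (\<rho> has_real_derivative K t (\<rho> t)) (at t within {0..pi})"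
      using P'[of x] x by auto
    let ?p = "\<psi> (\<sigma> * x ^ m, 0)" and ?q = "\<psi> (- \<sigma> * \<rho> pi ^ m, 0)"
    have V: "(\<sigma> * x ^ m, 0) \<in> V" "(- \<sigma> * \<rho> pi ^ m, 0) \<in> V"
      and tr: "travels Y ?p ?q ?S \<or> travels Y ?q ?p ?S"
      using arcs \<rho>' \<rho>(1) unfolding sector_arcs_def by blast+
    have pos: "0 < x" "0 < \<rho> pi" using x \<rho>' by auto
    \<comment> \<open>The bound 1 on x is there for this: x^m stays below \<kappa>, where the sign
      of the Lie derivative is known.\<close>
    have "x ^ m \<le> x" using power_decreasing[of 1 m x] m x by simp
    then have xm: "x ^ m \<in> {0<..<\<kappa>}" using x by auto
    have on_Sw: "f (\<psi> (x', 0)) = 0" if "(x', 0) \<in> V" for x'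
      using straightening_sign(1)[OF st that] by simp
    have "\<not> travels Y ?q ?p ?S"
    proof
      assume "travels Y ?q ?p ?S"
      from travels_lie_derivative_end[OF f this on_Sw[OF V(1)], of \<nu>]
      show False using lie[OF xm] by simp
    qed
    with tr have go: "travels Y ?p ?q ?S" by blast
    moreover have "\<sigma> * x ^ m * (- \<sigma> * \<rho> pi ^ m) < 0" using pos \<sigma> by auto
    ultimately have "half_returns Y ?S V \<psi> (\<sigma> * x ^ m) (- \<sigma> * \<rho> pi ^ m)"
      unfolding half_returns_iff_travels using V by blast
    moreover have "x' = - \<sigma> * \<rho> pi ^ m" if "half_returns Y ?S V \<psi> (\<sigma> * x ^ m) x'" for x'
    proof -
      have x': "(x', 0) \<in> V" "travels Y ?p (\<psi> (x', 0)) ?S"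
        using that unfolding half_returns_iff_travels by auto
      have "\<psi> (x', 0) = ?q"
        by (rule travels_unique[OF lip x'(2) go]) (use on_Sw[OF x'(1)] on_Sw[OF V(2)] in auto)
      then show ?thesis
        using inj_onD[OF straightening_psi(3)[OF st] _ x'(1) V(2)] by simp
    qed
    ultimately show ?thesis using \<rho>(2) by blast
  qed
  then show ?thesis
    using P \<kappa> by (intro exI[of _ P] exI[of _ "min \<epsilon> (min 1 \<kappa>)"]) auto
qed

text \<open>The branch from which the orbits on f > 0 leave is found from one sample arc: at its
  starting point the Lie derivative is nonnegative, hence positive, and it keeps this sign along the
  branch because it never vanishes there.\<close>

lemma rotation_direction:
  assumes f: "real_analytic_on f UNIV" and X: "analytic_vector_field X"
    and st: "straightening f p0 U V \<phi> \<psi>" and m: "m > 0"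
    and arcs: "sector_arcs f X V \<psi> K m 1 1 \<delta>" and \<delta>: "\<delta> > 0"
    and flow: "\<And>\<delta>. \<delta> > 0 \<Longrightarrow> analytic_flow K \<delta> 0 pi"
    and \<kappa>: "\<kappa> > 0" and V: "\<And>x. \<bar>x\<bar> < \<kappa> \<Longrightarrow> (x, 0) \<in> V"
    and nz: "\<And>x. \<bar>x\<bar> < \<kappa> \<Longrightarrow> x \<noteq> 0 \<Longrightarrow> lie_derivative X f (\<psi> (x, 0)) \<noteq> 0"
  obtains \<sigma> :: real where "\<sigma> = 1 \<or> \<sigma> = - 1"
    "\<And>x. x \<in> {0<..<\<kappa>} \<Longrightarrow> lie_derivative X f (\<psi> (\<sigma> * x, 0)) > 0"
proof -
  define l where "l x = lie_derivative X f (\<psi> (x, 0))" for x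
  have "continuous_on {-\<kappa><..<\<kappa>} (\<lambda>x. \<psi> (x, 0))"
    by (rule continuous_on_compose2[OF straightening_psi(1)[OF st]])
       (use V in \<open>auto intro!: continuous_intros\<close>)
  then have cont: "continuous_on {-\<kappa><..<\<kappa>} l"
    unfolding l_def by (rule continuous_on_compose2[OF continuous_on_lie_derivative[OF f X]]) auto
  \<comment> \<open>The condition \<open>a * x > 0\<close> says that a and x lie on the same
    branch.\<close>
  have sign: "l x > 0" if "a * x > 0" "\<bar>a\<bar> < \<kappa>" "\<bar>x\<bar> < \<kappa>" "l a > 0" for a x
  proof (cases "a > 0")
    case True
    show ?thesis
      by (rule continuous_nonzero_constant_sign[of "{0<..<\<kappa>}" l a])
         (use True that cont nz \<kappa> in \<open>auto simp: l_def zero_less_mult_iff intro: continuous_on_subset\<close>)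
  next
    case False
    show ?thesis
      by (rule continuous_nonzero_constant_sign[of "{-\<kappa><..<0}" l a])
         (use False that cont nz \<kappa> in \<open>auto simp: l_def zero_less_mult_iff intro: continuous_on_subset\<close>)
  qed
  \<comment> \<open>Solutions below 1 and \<kappa> have end points \<rho>^m below \<kappa>, within
    reach of the sign statement.\<close>
  define \<delta>' where "\<delta>' = min \<delta> (min 1 \<kappa>)"
  have \<delta>': "\<delta>' > 0" using \<delta> \<kappa> by (simp add: \<delta>'_def)
  obtain \<epsilon> P where "\<epsilon> > 0" and P': "\<And>x. x \<in> {0<..<\<epsilon>} \<Longrightarrow> \<exists>\<rho>. \<rho> 0 = x \<and> P (complex_of_real x) = complex_of_real (\<rho> pi) \<and>
        (\<forall>t\<in>{0..pi}. 0 < \<rho> t \<and> \<rho> t < \<delta>' \<and> (\<rho> has_real_derivative K t (\<rho> t)) (at t within {0..pi}))"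
    using flow[OF \<delta>'] unfolding analytic_flow_def by blast
  obtain \<rho> where \<rho>: "\<And>t. t \<in> {0..pi} \<Longrightarrow> 0 < \<rho> t \<and> \<rho> t < \<delta>' \<and> (\<rho> has_real_derivative K t (\<rho> t)) (at t within {0..pi})"
  proof -
    have "\<epsilon> / 2 \<in> {0<..<\<epsilon>}" using \<open>\<epsilon> > 0\<close> by simp
    from P'[OF this] that show thesis by blast
  qed
  define x y where "x = \<rho> 0 ^ m" and "y = \<rho> pi ^ m"
  have small: "\<rho> t ^ m \<in> {0<..<\<kappa>}" if "t \<in> {0..pi}" for t
    using \<rho>[OF that] power_decreasing[of 1 m "\<rho> t"] m by (auto simp: \<delta>'_def)
  have x: "x \<in> {0<..<\<kappa>}" and y: "y \<in> {0<..<\<kappa>}"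
    using small[of 0] small[of pi] by (auto simp: x_def y_def)
  have tr: "travels X (\<psi> (x, 0)) (\<psi> (- y, 0)) {p. 1 * f p > 0} \<or>
      travels X (\<psi> (- y, 0)) (\<psi> (x, 0)) {p. 1 * f p > 0}"
  proof -
    have "\<forall>t\<in>{0..pi}. 0 < \<rho> t \<and> \<rho> t < \<delta> \<and> (\<rho> has_real_derivative K t (\<rho> t)) (at t within {0..pi})"
      using \<rho> by (simp add: \<delta>'_def)
    with arcs have "travels X (\<psi> (1 * \<rho> 0 ^ m, 0)) (\<psi> (- 1 * \<rho> pi ^ m, 0)) {p. 1 * f p > 0} \<or>
        travels X (\<psi> (- 1 * \<rho> pi ^ m, 0)) (\<psi> (1 * \<rho> 0 ^ m, 0)) {p. 1 * f p > 0}"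
      unfolding sector_arcs_def by blast
    then show ?thesis by (simp add: x_def y_def)
  qed
  have on_Sw: "f (\<psi> (x', 0)) = 0" if "\<bar>x'\<bar> < \<kappa>" for x'
    using straightening_sign(1)[OF st V[OF that]] by simp
  from tr show thesis
  proof
    assume t: "travels X (\<psi> (x, 0)) (\<psi> (- y, 0)) {p. 1 * f p > 0}"
    have "1 * l x \<ge> 0"
      unfolding l_def by (rule travels_lie_derivative_start[OF f t]) (use on_Sw x in auto)
    with nz[of x] x have "l x > 0" by (auto simp: l_def)
    then show thesis using that[of 1] sign[of x] x unfolding l_def by (simp add: zero_less_mult_iff)
  next
    assume t: "travels X (\<psi> (- y, 0)) (\<psi> (x, 0)) {p. 1 * f p > 0}"
    have "1 * l (- y) \<ge> 0"
      unfolding l_def by (rule travels_lie_derivative_start[OF f t]) (use on_Sw y in auto)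
    with nz[of "- y"] y have "l (- y) > 0" by (auto simp: l_def)
    then show thesis using that[of "- 1"] sign[of "- y"] y unfolding l_def by (simp add: zero_less_mult_iff)
  qed
qed

text \<open>The inverse is x to \<open>root N (\<sigma> * x)\<close>, with \<kappa> = \<epsilon>^N.
  For N > 1 it is not differentiable at 0: the parameter is a homeomorphic one only.\<close>

lemma branch_coordinate_power:
  assumes "\<sigma> = 1 \<or> \<sigma> = - 1" and "\<epsilon> > 0" and "N > 0"
  shows "branch_coordinate \<sigma> \<epsilon> (\<lambda>w. \<sigma> * w ^ N)"
  unfolding branch_coordinate_def
proof (intro conjI exI)
  have \<sigma>\<sigma>: "\<sigma> * (\<sigma> * x) = x" for x using assms(1) by auto
  show "\<epsilon> ^ N > 0" using assms by simp
  show "homeomorphism {0..<\<epsilon>} ((\<lambda>u. \<sigma> * u) ` {0..<\<epsilon> ^ N}) (\<lambda>w. \<sigma> * w ^ N) (\<lambda>x. root N (\<sigma> * x))"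
  proof (rule homeomorphismI)
    have "w ^ N < \<epsilon> ^ N" if "w \<in> {0..<\<epsilon>}" for w
      using that assms(3) by (intro power_strict_mono) auto
    then show "(\<lambda>w. \<sigma> * w ^ N) ` {0..<\<epsilon>} \<subseteq> (\<lambda>u. \<sigma> * u) ` {0..<\<epsilon> ^ N}" by force
    have "root N u < \<epsilon>" if "u \<in> {0..<\<epsilon> ^ N}" for u
      using real_root_less_mono[of N u "\<epsilon> ^ N"] real_root_power_cancel[of N \<epsilon>] that assms by auto
    then show "(\<lambda>x. root N (\<sigma> * x)) ` ((\<lambda>u. \<sigma> * u) ` {0..<\<epsilon> ^ N}) \<subseteq> {0..<\<epsilon>}"
      using assms(3) by (auto simp: \<sigma>\<sigma>)
  qed (use assms \<sigma>\<sigma> in \<open>auto simp: real_root_power_cancel real_root_pow_pos2 intro!: continuous_intros\<close>)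
qed (use assms in auto)

theorem theorem13:
  fixes f :: "plane \<Rightarrow> real" and Xp Xm \<phi> \<psi> :: "plane \<Rightarrow> plane"
    and p0 :: plane and U V :: "plane set"
  assumes "real_analytic_on f UNIV" and "zero_regular_value f"
    and "analytic_vector_field Xp" and "analytic_vector_field Xm"
    and "monodromic f Xp Xm p0"
    and "hypothesis_H f Xp Xm p0 U V \<phi> \<psi>"
  shows "\<exists>\<sigma>\<in>{1, -1}. \<exists>\<epsilon> > 0. \<exists>h. branch_coordinate \<sigma> \<epsilon> h \<and>
           (\<forall>w\<in>{0<..<\<epsilon>}. displacement_defined f Xp Xm V \<psi> (h w)) \<and>
           (\<exists>a. \<forall>w\<in>{0..<\<epsilon>}. (\<lambda>n. a n * w ^ n) sums displacement f Xp Xm V \<psi> (h w))"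
proof -
  note f = assms(1) and Xp = assms(3) and Xm = assms(4)
  have st: "straightening f p0 U V \<phi> \<psi>" using assms(6) by (simp add: hypothesis_H_def)
  obtain p q r s Fp Gp Fm Gm where "p > 0" "q > 0" "r > 0" "s > 0"
    and Fp: "real_analytic_on Fp (UNIV \<times> {0})" "real_analytic_on Gp (UNIV \<times> {0})"
      "\<And>\<theta>. Fp (\<theta>, 0) = 0" "\<And>\<theta>. \<theta> \<in> {0..pi} \<Longrightarrow> Gp (\<theta>, 0) \<noteq> 0"
    and Fm: "real_analytic_on Fm (UNIV \<times> {0})" "real_analytic_on Gm (UNIV \<times> {0})"
      "\<And>\<theta>. Fm (\<theta>, 0) = 0" "\<And>\<theta>. \<theta> \<in> {-pi..0} \<Longrightarrow> Gm (\<theta>, 0) \<noteq> 0"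
    and pe: "polar_equivalent Xp V \<psi> p r 0 pi Fp Gp" "polar_equivalent Xm V \<psi> q s (-pi) 0 Fm Gm"
    using conjunct2[OF assms(6)[unfolded hypothesis_H_def]]
    by (elim exE conjE) (rule that; (assumption | erule spec | erule bspec; assumption))
  obtain \<kappa> where \<kappa>: "\<kappa> > 0" and V: "\<And>x. \<bar>x\<bar> < \<kappa> \<Longrightarrow> (x, 0) \<in> V"
    and sew: "\<And>x. \<bar>x\<bar> < \<kappa> \<Longrightarrow> x \<noteq> 0 \<Longrightarrow>
       lie_derivative Xp f (\<psi> (x, 0)) * lie_derivative Xm f (\<psi> (x, 0)) > 0"
    using monodromic_sewing_near[OF assms(5) st] by blast
  have flowp: "analytic_flow (polar_rhs Fp Gp \<sigma> 1) \<delta> 0 pi"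
    and flowm: "analytic_flow (polar_rhs Fm Gm \<sigma> (-1)) \<delta> 0 pi"
    if "\<sigma> = 1 \<or> \<sigma> = - 1" "\<delta> > 0" for \<sigma> \<delta>
    by (rule polar_flow; use Fp Fm that in simp)+
  have arcp: "\<exists>\<delta>>0. sector_arcs f Xp V \<psi> (polar_rhs Fp Gp \<sigma> 1) p \<sigma> 1 \<delta>"
    and arcm: "\<exists>\<delta>>0. sector_arcs f Xm V \<psi> (polar_rhs Fm Gm \<sigma> (-1)) q \<sigma> (-1) \<delta>"
    if "\<sigma> = 1 \<or> \<sigma> = - 1" for \<sigma>
    by (rule polar_equivalent_sector_arcs[OF st that]; use pe in simp)+
  \<comment> \<open>The sample arcs that determine \<sigma> are parametrised from the positive
    branch, whichever way the orbits run.\<close>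
  obtain \<delta>0 where \<delta>0: "\<delta>0 > 0" "sector_arcs f Xp V \<psi> (polar_rhs Fp Gp 1 1) p 1 1 \<delta>0"
    using arcp[of 1] by auto
  obtain \<sigma> :: real where \<sigma>: "\<sigma> = 1 \<or> \<sigma> = - 1"
    and lp: "\<And>x. x \<in> {0<..<\<kappa>} \<Longrightarrow> lie_derivative Xp f (\<psi> (\<sigma> * x, 0)) > 0"
    by (rule rotation_direction[OF f Xp st \<open>p > 0\<close> \<delta>0(2,1) flowp \<kappa> V])
       (use sew in force)+
  \<comment> \<open>Sewing transfers the sign to Xm, so -Xm points into f < 0 along the same branch,
    and both half-returns start there.\<close>
  have lm: "lie_derivative Xm f (\<psi> (\<sigma> * x, 0)) > 0" if "x \<in> {0<..<\<kappa>}" for x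
    using lp[OF that] sew[of "\<sigma> * x"] that \<sigma> by (auto simp: zero_less_mult_iff)
  obtain \<delta>p \<delta>m where \<delta>p: "\<delta>p > 0" "sector_arcs f Xp V \<psi> (polar_rhs Fp Gp \<sigma> 1) p \<sigma> 1 \<delta>p"
    and \<delta>m: "\<delta>m > 0" "sector_arcs f Xm V \<psi> (polar_rhs Fm Gm \<sigma> (-1)) q \<sigma> (-1) \<delta>m"
    using arcp[OF \<sigma>] arcm[OF \<sigma>] by blast
  let ?Xm = "\<lambda>p. - Xm p"
  have S: "{p. 1 * f p > 0} = Sw_pos f" "{p. - 1 * f p > 0} = Sw_neg f"
    by (auto simp: Sw_pos_def Sw_neg_def)
  obtain P \<epsilon>1 where P: "\<epsilon>1 > 0" "P analytic_on {0}" "P 0 = 0"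
    and hp: "\<And>x. x \<in> {0<..<\<epsilon>1} \<Longrightarrow> \<exists>y. P (complex_of_real x) = complex_of_real y \<and>
      half_returns Xp (Sw_pos f) V \<psi> (\<sigma> * x ^ p) (- \<sigma> * y ^ p) \<and>
      (\<forall>x'. half_returns Xp (Sw_pos f) V \<psi> (\<sigma> * x ^ p) x' \<longrightarrow> x' = - \<sigma> * y ^ p)"
    using half_return_analytic[OF f analytic_vector_field_locally_lipschitz[OF Xp] st \<sigma> _ \<open>p > 0\<close>
        \<delta>p(2) flowp[OF \<sigma> \<delta>p(1)] \<kappa>] lp unfolding S by auto
  obtain Q \<epsilon>2 where Q: "\<epsilon>2 > 0" "Q analytic_on {0}" "Q 0 = 0"
    and hm: "\<And>x. x \<in> {0<..<\<epsilon>2} \<Longrightarrow> \<exists>y. Q (complex_of_real x) = complex_of_real y \<and>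
      half_returns ?Xm (Sw_neg f) V \<psi> (\<sigma> * x ^ q) (- \<sigma> * y ^ q) \<and>
      (\<forall>x'. half_returns ?Xm (Sw_neg f) V \<psi> (\<sigma> * x ^ q) x' \<longrightarrow> x' = - \<sigma> * y ^ q)"
    using half_return_analytic[OF f locally_lipschitz_minus[OF analytic_vector_field_locally_lipschitz[OF Xm]]
        st \<sigma> _ \<open>q > 0\<close> sector_arcs_minus[OF \<delta>m(2)] flowm[OF \<sigma> \<delta>m(1)] \<kappa>] lm
    unfolding S lie_derivative_minus by auto
  \<comment> \<open>The half-returns end at -\<sigma> * y^p with y = P (w^q) and at -\<sigma> * z^q
    with z = Q (w^p); the minus signs explain the order of the two terms.\<close>
  define \<Phi> where "\<Phi> w = of_real \<sigma> * (Q (w ^ p) ^ q - P (w ^ q) ^ p)" for w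
  have comp: "(\<lambda>w. R (w ^ n)) analytic_on {0}" if "R analytic_on {0}" "n > 0" for R :: "complex \<Rightarrow> complex" and n
  proof -
    have "(R \<circ> (\<lambda>w. w ^ n)) analytic_on {0}"
      by (rule analytic_on_compose) (use that in \<open>auto intro!: analytic_intros simp: zero_power\<close>)
    then show ?thesis by (simp add: o_def)
  qed
  have "\<Phi> analytic_on {0}"
    unfolding \<Phi>_def using P Q \<open>p > 0\<close> \<open>q > 0\<close> by (intro analytic_intros comp) auto
  then obtain e where e: "e > 0" "\<Phi> holomorphic_on ball 0 e"
    by (auto simp: analytic_at_ball)
  \<comment> \<open>The bound 1 makes every positive power of w at most w, so that w^q and w^p stay
    below \<epsilon>1 and \<epsilon>2.\<close>
  define \<epsilon> where "\<epsilon> = min (min 1 e) (min \<epsilon>1 \<epsilon>2)"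
  have \<epsilon>: "\<epsilon> > 0" using e P Q by (simp add: \<epsilon>_def)
  define N where "N = p * q"
  have N: "N > 0" using \<open>p > 0\<close> \<open>q > 0\<close> by (simp add: N_def)
  define h where "h w = \<sigma> * w ^ N" for w
  have main: "displacement_defined f Xp Xm V \<psi> (h w) \<and>
      complex_of_real (displacement f Xp Xm V \<psi> (h w)) = \<Phi> (of_real w)" if w: "w \<in> {0<..<\<epsilon>}" for w
  proof -
    have pw: "w ^ n \<in> {0<..<\<epsilon>}" if "n > 0" for n
      using power_decreasing[of 1 n w] that w by (auto simp: \<epsilon>_def)
    have hw: "h w = \<sigma> * (w ^ q) ^ p" "h w = \<sigma> * (w ^ p) ^ q"
      by (simp_all add: h_def N_def power_mult[symmetric] mult.commute)
    obtain y where y: "P (complex_of_real (w ^ q)) = complex_of_real y"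
      "half_returns Xp (Sw_pos f) V \<psi> (h w) (- \<sigma> * y ^ p)"
      "\<And>x'. half_returns Xp (Sw_pos f) V \<psi> (h w) x' \<Longrightarrow> x' = - \<sigma> * y ^ p"
      using hp[of "w ^ q"] pw[OF \<open>q > 0\<close>] unfolding hw(1) by (auto simp: \<epsilon>_def)
    obtain z where z: "Q (complex_of_real (w ^ p)) = complex_of_real z"
      "half_returns ?Xm (Sw_neg f) V \<psi> (h w) (- \<sigma> * z ^ q)"
      "\<And>x'. half_returns ?Xm (Sw_neg f) V \<psi> (h w) x' \<Longrightarrow> x' = - \<sigma> * z ^ q"
      using hm[of "w ^ p"] pw[OF \<open>p > 0\<close>] unfolding hw(2) by (auto simp: \<epsilon>_def)
    have "h w \<noteq> 0" using w \<sigma> by (auto simp: h_def)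
    moreover have "(THE x'. half_returns Xp (Sw_pos f) V \<psi> (h w) x') = - \<sigma> * y ^ p"
      by (rule the_equality) (fact y)+
    moreover have "(THE x'. half_returns ?Xm (Sw_neg f) V \<psi> (h w) x') = - \<sigma> * z ^ q"
      by (rule the_equality) (fact z)+
    ultimately have "half_return Xp (Sw_pos f) V \<psi> (h w) = - \<sigma> * y ^ p"
      "half_return ?Xm (Sw_neg f) V \<psi> (h w) = - \<sigma> * z ^ q"
      by (simp_all add: half_return_def)
    then have "displacement f Xp Xm V \<psi> (h w) = \<sigma> * (z ^ q - y ^ p)"
      by (simp add: displacement_def algebra_simps)
    moreover have "\<Phi> (of_real w) = of_real (\<sigma> * (z ^ q - y ^ p))"
      using y(1) z(1) by (simp add: \<Phi>_def)
    moreover have "displacement_defined f Xp Xm V \<psi> (h w)"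
      unfolding displacement_defined_def using y(2,3) z(2,3) by blast
    ultimately show ?thesis by simp
  qed
  \<comment> \<open>At w = 0 \<open>half_return\<close> has its separately defined value 0, which
    agrees with \<Phi> because P and Q vanish at 0.\<close>
  have zero: "complex_of_real (displacement f Xp Xm V \<psi> (h 0)) = \<Phi> (of_real 0)"
    using N \<open>p > 0\<close> \<open>q > 0\<close> P(3) Q(3) by (simp add: displacement_def half_return_def h_def \<Phi>_def zero_power)
  \<comment> \<open>\<Phi> is real at real w in [0, \<epsilon>), so the real parts of its Taylor
    coefficients already sum to the displacement.\<close>
  define a where "a n = Re ((deriv ^^ n) \<Phi> 0 / fact n)" for n
  have "(\<lambda>n. a n * w ^ n) sums displacement f Xp Xm V \<psi> (h w)" if w: "w \<in> {0..<\<epsilon>}" for w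
  proof -
    have "(\<lambda>n. (deriv ^^ n) \<Phi> 0 / fact n * (of_real w - 0) ^ n) sums \<Phi> (of_real w)"
      by (rule holomorphic_power_series[OF e(2)]) (use w in \<open>auto simp: \<epsilon>_def\<close>)
    then have "(\<lambda>n. (deriv ^^ n) \<Phi> 0 / fact n * of_real (w ^ n)) sums of_real (displacement f Xp Xm V \<psi> (h w))"
      using main[of w] zero w by (cases "w = 0") auto
    then have "(\<lambda>n. Re ((deriv ^^ n) \<Phi> 0 / fact n * of_real (w ^ n))) sums
        Re (of_real (displacement f Xp Xm V \<psi> (h w)))"
      by (rule sums_Re)
    moreover have "Re (c * of_real x) = Re c * x" for c x by simp
    ultimately show ?thesis unfolding a_def by (simp only: Re_complex_of_real)
  qed
  then show ?thesis
    using \<sigma> \<epsilon> main branch_coordinate_power[OF \<sigma> \<epsilon> N] unfolding h_def[abs_def, symmetric]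
    by (intro bexI[of _ \<sigma>] exI[of _ \<epsilon>] conjI exI[of _ h] exI[of _ a]) (auto simp: h_def[abs_def])
qed

end
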